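(* Let $p$ be a prime and let $G$ be a pro-$p$-group with normalized Haar measure $\mu$. Then \[\widehat{\mathrm{d}}(G)\leq \mathrm{d}(G)-\left(\frac{p-1}{p}\right)\left(\mu(Z(G))-\mu(\widehat{Z}(G))\right).\] Furthermore, if $H_2(G,\mathbb{Z}_p)$ is finite, then \[\widehat{\mathrm{d}}(G) \geq \mu(\widehat{Z}(G))+\frac{1}{|H_2(G,\mathbb{Z}_p)|}\left(\mathrm{d}(G)-\mu(\widehat{Z}(G))\right).\]
   Context: Conventions: $p$ is a prime, $x^y=y^{-1}xy$, $Z(G)$ is the center of $G$. A pro-$p$-group is a projective limit $G=\lim_{N\in\mathcal{P}(G)}G/N$, where $\mathcal{P}(G)$ is the set of closed normal subgroups $N$ of $G$ with $G/N$ a finite $p$-group. For a pro-$p$-group $G$, the complete nonabelian tensor square $G\widehat{\otimes}G$ is the pro-$p$-group topologically generated by symbols $x\widehat{\otimes}y$ ($x,y\in G$) subject to the relations $xy\widehat{\otimes}z=(x^y\widehat{\otimes}z^y)(y\widehat{\otimes}z)$ and $y\widehat{\otimes}tz=(y\widehat{\otimes}z)(y^z\widehat{\otimes}t^z)$ for all $x,y,z,t\in G$; equivalently $G\widehat{\otimes}G=\lim_{(N,M)\in\mathcal{P}(G)\times\mathcal{P}(G)}G/N\otimes G/M$ (projective limit of the ordinary nonabelian tensor products), and $(x,y)\mapsto x\widehat{\otimes}y$ is continuous. Let $\widehat{\nabla}(G)$ be the closed (central) subgroup generated by all $x\widehat{\otimes}x$, $x\in G$. The complete nonabelian exterior square is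 $G\widehat{\wedge}G=(G\widehat{\otimes}G)/\widehat{\nabla}(G)$, and $x\widehat{\wedge}y$ is the image of $x\widehat{\otimes}y$. The Schur multiplier $H_2(G,\mathbb{Z}_p)$ (second homology group of the pro-$p$-group $G$ with coefficients in the $p$-adic integers $\mathbb{Z}_p$) is identified with the kernel of the epimorphism $G\widehat{\wedge}G\to G'$, $x\widehat{\wedge}y\mapsto[x,y]$; it is a closed central subgroup of $G\widehat{\wedge}G$. The complete exterior center is the subgroup $\widehat{Z}(G)=\{g\in G\mid g\widehat{\wedge}y=1\ \text{for all } y\in G\}$. $\mu$ is the unique normalized Haar measure on $G$. The exterior degree is $\widehat{\mathrm{d}}(G)=(\mu\times\mu)(\{(x,y)\in G\times G\mid x\widehat{\wedge}y=1\})$. The commutativity degree is $\mathrm{d}(G)=(\mu\times\mu)(\{(x,y)\in G\times G\mid [x,y]=1\})$. *)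

theory Defs
  imports "HOL-Analysis.Analysis" "HOL-Algebra.Product_Groups"
    "HOL-Computational_Algebra.Primes"
begin

section \<open>Pro-p-groups\<close>

definition conjugate :: "('a, 'm) monoid_scheme \<Rightarrow> 'a \<Rightarrow> 'a \<Rightarrow> 'a" where
  "conjugate G x y = inv\<^bsub>G\<^esub> y \<otimes>\<^bsub>G\<^esub> x \<otimes>\<^bsub>G\<^esub> y"

text \<open>The convention \<open>[x, y] = x\<inverse> y\<inverse> x y\<close> is the one for which \<open>(x, y) \<mapsto> [x, y]\<close> satisfies
  the two defining relations of the tensor square below.\<close>

definition commutator :: "('a, 'm) monoid_scheme \<Rightarrow> 'a \<Rightarrow> 'a \<Rightarrow> 'a" where
  "commutator G x y = inv\<^bsub>G\<^esub> x \<otimes>\<^bsub>G\<^esub> inv\<^bsub>G\<^esub> y \<otimes>\<^bsub>G\<^esub> x \<otimes>\<^bsub>G\<^esub> y"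

definition group_center :: "('a, 'm) monoid_scheme \<Rightarrow> 'a set" where
  "group_center G = {z \<in> carrier G. \<forall>x\<in>carrier G. z \<otimes>\<^bsub>G\<^esub> x = x \<otimes>\<^bsub>G\<^esub> z}"

definition topological_group :: "('a, 'm) monoid_scheme \<Rightarrow> 'a topology \<Rightarrow> bool" where
  "topological_group G T \<longleftrightarrow> group G \<and> topspace T = carrier G \<and>
     continuous_map (prod_topology T T) T (\<lambda>(x, y). x \<otimes>\<^bsub>G\<^esub> y) \<and>
     continuous_map T T (\<lambda>x. inv\<^bsub>G\<^esub> x)"

definition p_quotients :: "nat \<Rightarrow> ('a, 'm) monoid_scheme \<Rightarrow> 'a topology \<Rightarrow> 'a set set" where
  "p_quotients p G T =
     {N. N \<lhd> G \<and> closedin T N \<and> finite (carrier (G Mod N)) \<and> (\<exists>k. order (G Mod N) = p ^ k)}"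

text \<open>The projective limit of the finite groups \<open>G/N\<close>. For \<open>N \<subseteq> M\<close> the canonical map
  \<open>G/N \<rightarrow> G/M\<close> sends a coset of \<open>N\<close> to the unique coset of \<open>M\<close> containing it.\<close>

definition quotient_limit :: "nat \<Rightarrow> ('a, 'm) monoid_scheme \<Rightarrow> 'a topology \<Rightarrow> ('a set \<Rightarrow> 'a set) set" where
  "quotient_limit p G T =
     {f \<in> (\<Pi>\<^sub>E N\<in>p_quotients p G T. carrier (G Mod N)).
        \<forall>N\<in>p_quotients p G T. \<forall>M\<in>p_quotients p G T. N \<subseteq> M \<longrightarrow> f N \<subseteq> f M}"

definition quotient_limit_topology ::
    "nat \<Rightarrow> ('a, 'm) monoid_scheme \<Rightarrow> 'a topology \<Rightarrow> ('a set \<Rightarrow> 'a set) topology" where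
  "quotient_limit_topology p G T =
     subtopology
       (product_topology (\<lambda>N. discrete_topology (carrier (G Mod N))) (p_quotients p G T))
       (quotient_limit p G T)"

definition pro_p_group :: "nat \<Rightarrow> ('a, 'm) monoid_scheme \<Rightarrow> 'a topology \<Rightarrow> bool" where
  "pro_p_group p G T \<longleftrightarrow> topological_group G T \<and>
     homeomorphic_map T (quotient_limit_topology p G T)
       (\<lambda>g. \<lambda>N\<in>p_quotients p G T. N #>\<^bsub>G\<^esub> g)"


section \<open>Haar measure\<close>

text \<open>Regular Borel probability measures on a compact Hausdorff space (for finite measures on
  such spaces, outer regularity on Borel sets implies inner regularity by compact sets).\<close>

definition radon_probability :: "'a topology \<Rightarrow> 'a measure \<Rightarrow> bool" where
  "radon_probability T \<mu> \<longleftrightarrow>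
     sets \<mu> = sigma_sets (topspace T) {U. openin T U} \<and>
     emeasure \<mu> (topspace T) = 1 \<and>
     (\<forall>A\<in>sets \<mu>. emeasure \<mu> A = (INF U\<in>{U. openin T U \<and> A \<subseteq> U}. emeasure \<mu> U))"

definition normalized_haar_measure ::
    "('a, 'm) monoid_scheme \<Rightarrow> 'a topology \<Rightarrow> 'a measure \<Rightarrow> bool" where
  "normalized_haar_measure G T \<mu> \<longleftrightarrow> radon_probability T \<mu> \<and>
     (\<forall>g\<in>carrier G. \<forall>A\<in>sets \<mu>. emeasure \<mu> (g <#\<^bsub>G\<^esub> A) = emeasure \<mu> A)"

text \<open>If \<open>T\<close> is not second countable, closed subsets of the product space need not belong to the
  product sigma-algebra of the Borel sigma-algebras, so the measure-theoretic product does not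
  see them. \<open>\<mu> \<times> \<mu>\<close> is therefore the Radon product: the unique regular Borel probability measure
  on the product space with the usual values on measurable rectangles.\<close>

definition radon_product :: "'a topology \<Rightarrow> 'a measure \<Rightarrow> ('a \<times> 'a) measure \<Rightarrow> bool" where
  "radon_product T \<mu> \<nu> \<longleftrightarrow> radon_probability (prod_topology T T) \<nu> \<and>
     (\<forall>A\<in>sets \<mu>. \<forall>B\<in>sets \<mu>. emeasure \<nu> (A \<times> B) = emeasure \<mu> A * emeasure \<mu> B)"


section \<open>The complete nonabelian tensor square\<close>

text \<open>Group words in the symbols \<open>x \<otimes> y\<close>: the letter \<open>(x, y, True)\<close> stands for \<open>x \<otimes> y\<close> and
  \<open>(x, y, False)\<close> for its inverse.\<close>

type_synonym 'a tword = "('a \<times> 'a \<times> bool) list"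

definition twords :: "('a, 'm) monoid_scheme \<Rightarrow> 'a tword set" where
  "twords G = lists (carrier G \<times> carrier G \<times> UNIV)"

text \<open>The congruence on words presenting \<open>G/N \<otimes> G/M\<close>. The generators are the symbols
  \<open>xN \<otimes> yM\<close>, written with representatives, so \<open>x \<otimes> y\<close> and \<open>x' \<otimes> y'\<close> are identified whenever
  \<open>xN = x'N\<close> and \<open>yM = y'M\<close>. The relations are imposed for all representatives; for \<open>N = M\<close> this
  is the presentation of the ordinary nonabelian tensor square of \<open>G/N\<close>, and for \<open>N \<noteq> M\<close> no
  compatibility of the conjugation actions has to be assumed.\<close>

inductive tcong :: "('a, 'm) monoid_scheme \<Rightarrow> 'a set \<Rightarrow> 'a set \<Rightarrow> 'a tword \<Rightarrow> 'a tword \<Rightarrow> bool"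
  for G :: "('a, 'm) monoid_scheme" and N M :: "'a set" where
  refl: "w \<in> twords G \<Longrightarrow> tcong G N M w w"
| sym: "tcong G N M u v \<Longrightarrow> tcong G N M v u"
| trans: "tcong G N M u v \<Longrightarrow> tcong G N M v w \<Longrightarrow> tcong G N M u w"
| append: "tcong G N M u u' \<Longrightarrow> tcong G N M v v' \<Longrightarrow> tcong G N M (u @ v) (u' @ v')"
| cancel: "x \<in> carrier G \<Longrightarrow> y \<in> carrier G \<Longrightarrow> tcong G N M [(x, y, b), (x, y, \<not> b)] []"
| coset: "x \<in> carrier G \<Longrightarrow> x' \<in> carrier G \<Longrightarrow> y \<in> carrier G \<Longrightarrow> y' \<in> carrier G \<Longrightarrow>
    N #>\<^bsub>G\<^esub> x = N #>\<^bsub>G\<^esub> x' \<Longrightarrow> M #>\<^bsub>G\<^esub> y = M #>\<^bsub>G\<^esub> y' \<Longrightarrow>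
    tcong G N M [(x, y, True)] [(x', y', True)]"
| mult_left: "x \<in> carrier G \<Longrightarrow> y \<in> carrier G \<Longrightarrow> z \<in> carrier G \<Longrightarrow>
    tcong G N M [(x \<otimes>\<^bsub>G\<^esub> y, z, True)] [(conjugate G x y, conjugate G z y, True), (y, z, True)]"
| mult_right: "y \<in> carrier G \<Longrightarrow> t \<in> carrier G \<Longrightarrow> z \<in> carrier G \<Longrightarrow>
    tcong G N M [(y, t \<otimes>\<^bsub>G\<^esub> z, True)] [(y, z, True), (conjugate G y z, conjugate G t z, True)]"

definition quotient_tensor ::
    "('a, 'm) monoid_scheme \<Rightarrow> 'a set \<Rightarrow> 'a set \<Rightarrow> 'a tword set monoid" where
  "quotient_tensor G N M =
     \<lparr>carrier = twords G // {(u, v). tcong G N M u v},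
      monoid.mult = (\<lambda>A B. {w. \<exists>u\<in>A. \<exists>v\<in>B. tcong G N M w (u @ v)}),
      one = {w. tcong G N M w []}\<rparr>"

text \<open>The projective limit of the groups \<open>G/N \<otimes> G/M\<close>. For \<open>N \<subseteq> N'\<close> and \<open>M \<subseteq> M'\<close> the congruence
  for \<open>(N, M)\<close> refines the one for \<open>(N', M')\<close>, and the canonical map sends a class to the unique
  class containing it.\<close>

definition complete_tensor ::
    "nat \<Rightarrow> ('a, 'm) monoid_scheme \<Rightarrow> 'a topology \<Rightarrow> ('a set \<times> 'a set \<Rightarrow> 'a tword set) monoid" where
  "complete_tensor p G T =
     (let P = p_quotients p G T; D = product_group (P \<times> P) (\<lambda>(N, M). quotient_tensor G N M)
      in D\<lparr>carrier := {t \<in> carrier D. \<forall>N\<in>P. \<forall>M\<in>P. \<forall>N'\<in>P. \<forall>M'\<in>P.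
                         N \<subseteq> N' \<longrightarrow> M \<subseteq> M' \<longrightarrow> t (N, M) \<subseteq> t (N', M')}\<rparr>)"

definition complete_tensor_topology ::
    "nat \<Rightarrow> ('a, 'm) monoid_scheme \<Rightarrow> 'a topology \<Rightarrow> ('a set \<times> 'a set \<Rightarrow> 'a tword set) topology" where
  "complete_tensor_topology p G T =
     subtopology
       (product_topology (\<lambda>(N, M). discrete_topology (carrier (quotient_tensor G N M)))
          (p_quotients p G T \<times> p_quotients p G T))
       (carrier (complete_tensor p G T))"

definition tensor_symbol ::
    "nat \<Rightarrow> ('a, 'm) monoid_scheme \<Rightarrow> 'a topology \<Rightarrow> 'a \<Rightarrow> 'a \<Rightarrow> 'a set \<times> 'a set \<Rightarrow> 'a tword set" where
  "tensor_symbol p G T x y =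
     (\<lambda>(N, M)\<in>p_quotients p G T \<times> p_quotients p G T. {w. tcong G N M w [(x, y, True)]})"


section \<open>The complete nonabelian exterior square\<close>

definition complete_nabla ::
    "nat \<Rightarrow> ('a, 'm) monoid_scheme \<Rightarrow> 'a topology \<Rightarrow> ('a set \<times> 'a set \<Rightarrow> 'a tword set) set" where
  "complete_nabla p G T =
     complete_tensor_topology p G T closure_of
       generate (complete_tensor p G T) {tensor_symbol p G T x x |x. x \<in> carrier G}"

definition complete_exterior ::
    "nat \<Rightarrow> ('a, 'm) monoid_scheme \<Rightarrow> 'a topology \<Rightarrow> ('a set \<times> 'a set \<Rightarrow> 'a tword set) set monoid" where
  "complete_exterior p G T = complete_tensor p G T Mod complete_nabla p G T"

definition exterior_symbol ::
    "nat \<Rightarrow> ('a, 'm) monoid_scheme \<Rightarrow> 'a topology \<Rightarrow> 'a \<Rightarrow> 'a \<Rightarrow>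
       ('a set \<times> 'a set \<Rightarrow> 'a tword set) set" where
  "exterior_symbol p G T x y =
     complete_nabla p G T #>\<^bsub>complete_tensor p G T\<^esub> tensor_symbol p G T x y"

text \<open>The continuous homomorphism from the complete tensor square to \<open>G\<close> sending the symbol of
  \<open>x, y\<close> to \<open>[x, y]\<close>: evaluating symbols as commutators induces maps \<open>G/N \<otimes> G/N \<rightarrow> G/N\<close>, and
  \<open>G\<close> is the projective limit of the groups \<open>G/N\<close>.\<close>

definition tword_commutator :: "('a, 'm) monoid_scheme \<Rightarrow> 'a tword \<Rightarrow> 'a" where
  "tword_commutator G w =
     foldr (\<lambda>(x, y, b) g. (if b then commutator G x y else inv\<^bsub>G\<^esub> commutator G x y) \<otimes>\<^bsub>G\<^esub> g) w \<one>\<^bsub>G\<^esub>"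

definition tensor_commutator ::
    "nat \<Rightarrow> ('a, 'm) monoid_scheme \<Rightarrow> 'a topology \<Rightarrow> ('a set \<times> 'a set \<Rightarrow> 'a tword set) \<Rightarrow> 'a" where
  "tensor_commutator p G T t =
     (THE g. g \<in> carrier G \<and>
        (\<forall>N\<in>p_quotients p G T. \<forall>w\<in>t (N, N). tword_commutator G w \<in> N #>\<^bsub>G\<^esub> g))"

text \<open>The induced map on the quotient by the closed subgroup generated by all symbols of \<open>x, x\<close>.\<close>

definition exterior_commutator ::
    "nat \<Rightarrow> ('a, 'm) monoid_scheme \<Rightarrow> 'a topology \<Rightarrow> ('a set \<times> 'a set \<Rightarrow> 'a tword set) set \<Rightarrow> 'a" where
  "exterior_commutator p G T X = the_elem (tensor_commutator p G T ` X)"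

text \<open>\<open>H\<^sub>2(G, \<int>\<^sub>p)\<close>, in its identification with the kernel of the commutator map on the complete
  exterior square.\<close>

definition schur_multiplier ::
    "nat \<Rightarrow> ('a, 'm) monoid_scheme \<Rightarrow> 'a topology \<Rightarrow> ('a set \<times> 'a set \<Rightarrow> 'a tword set) set set" where
  "schur_multiplier p G T = kernel (complete_exterior p G T) G (exterior_commutator p G T)"

definition exterior_center :: "nat \<Rightarrow> ('a, 'm) monoid_scheme \<Rightarrow> 'a topology \<Rightarrow> 'a set" where
  "exterior_center p G T =
     {g \<in> carrier G. \<forall>y\<in>carrier G. exterior_symbol p G T g y = \<one>\<^bsub>complete_exterior p G T\<^esub>}"


section \<open>Degrees\<close>

text \<open>In both definitions \<open>\<nu>\<close> is the product measure \<open>\<mu> \<times> \<mu>\<close>.\<close>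

definition exterior_degree ::
    "nat \<Rightarrow> ('a, 'm) monoid_scheme \<Rightarrow> 'a topology \<Rightarrow> ('a \<times> 'a) measure \<Rightarrow> real" where
  "exterior_degree p G T \<nu> =
     measure \<nu> {(x, y). x \<in> carrier G \<and> y \<in> carrier G \<and>
       exterior_symbol p G T x y = \<one>\<^bsub>complete_exterior p G T\<^esub>}"

definition commutativity_degree :: "('a, 'm) monoid_scheme \<Rightarrow> ('a \<times> 'a) measure \<Rightarrow> real" where
  "commutativity_degree G \<nu> =
     measure \<nu> {(x, y). x \<in> carrier G \<and> y \<in> carrier G \<and> commutator G x y = \<one>\<^bsub>G\<^esub>}"

end

theory Submission
  imports Defs
begin

text \<open>The wedge of \<open>x\<close> and \<open>y\<close> has an image in the exterior square of every finite quotient \<open>G / N\<close>,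
  where \<open>N\<close> runs over the closed normal subgroups of \<open>p\<close>-power index. Since the tensor square
  carries the limit topology and \<open>\<nabla>\<close> is closed, \<open>x \<and> y\<close> is trivial if and only if all these images
  are (\<open>exterior_symbol_eq_one_iff\<close>); likewise \<open>[x, y] = 1\<close> if and only if \<open>[x, y] \<in> N\<close> for all
  \<open>N\<close>. So the two sets of pairs that define the degrees are directed intersections of unions of
  products of cosets of \<open>N\<close>. For such unions Fubini's theorem is a finite sum (\<open>measure_slices\<close>),
  and compactness with outer regularity allows the passage to the limit (\<open>P_compactness\<close>,
  \<open>radon_limit\<close>). In this way the measure theory is reduced to counting in finite groups, for
  groups of any topological weight.

  For the upper bound, the elements \<open>y\<close> with \<open>x \<and> y\<close> trivial at level \<open>N\<close> form a subgroup, and a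
  proper subgroup has measure at most \<open>1 / p\<close>. Over the center of \<open>G\<close>, where every pair commutes,
  all slices are of this kind except those over the exterior center of level \<open>N\<close>. Away from the
  center it is enough that a trivial wedge forces a trivial commutator.

  For the lower bound, \<open>x \<and> z = x' \<and> z\<close> if and only if \<open>x x'\<inverse> \<and> z\<close> is trivial
  (\<open>econg_mult_left_iff\<close>). So the index of the exterior centralizer of \<open>z\<close> in its centralizer is
  at most the number of values of the wedge on commuting pairs, and these values lie in the Schur
  multiplier. If the multiplier is finite, this count can be made at a finite level: a single
  level \<open>M\<close> separates the nontrivial values of commuting pairs from the trivial one
  (\<open>wedge_pairs_at_finite_level\<close>), and by compactness pairs that commute modulo a small enough \<open>N\<close>
  take no values at level \<open>M\<close> other than those of commuting pairs
  (\<open>commuting_values_at_finite_level\<close>). Over the exterior center the slices are everything.\<close>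

section \<open>Words in the symbols of the tensor square\<close>

context group
begin

lemma inv_mult_cancel [simp]:
  assumes "x \<in> carrier G" "y \<in> carrier G"
  shows "x \<otimes> (inv x \<otimes> y) = y" "inv x \<otimes> (x \<otimes> y) = y"
  using assms by (simp_all add: m_assoc [symmetric])

lemma conjugate_closed [simp]:
  "x \<in> carrier G \<Longrightarrow> y \<in> carrier G \<Longrightarrow> conjugate G x y \<in> carrier G"
  by (simp add: conjugate_def)

lemma commutator_closed [simp]:
  "x \<in> carrier G \<Longrightarrow> y \<in> carrier G \<Longrightarrow> commutator G x y \<in> carrier G"
  by (simp add: commutator_def)

lemma conjugate_mult:
  assumes "x \<in> carrier G" "y \<in> carrier G" "z \<in> carrier G"
  shows "conjugate G (x \<otimes> y) z = conjugate G x z \<otimes> conjugate G y z"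
  using assms by (simp add: conjugate_def m_assoc)

lemma conjugate_conjugate:
  assumes "x \<in> carrier G" "y \<in> carrier G" "z \<in> carrier G"
  shows "conjugate G (conjugate G x z) (conjugate G y z) = conjugate G (conjugate G x y) z"
  using assms by (simp add: conjugate_def m_assoc inv_mult_group)

lemma conjugate_inv_cancel [simp]:
  assumes "x \<in> carrier G" "z \<in> carrier G"
  shows "conjugate G (conjugate G x z) (inv z) = x" "conjugate G (conjugate G x (inv z)) z = x"
  using assms by (simp_all add: conjugate_def m_assoc inv_mult_group)

lemma conjugate_self [simp]: "x \<in> carrier G \<Longrightarrow> conjugate G x x = x"
  by (simp add: conjugate_def m_assoc)

lemma commutator_self [simp]: "x \<in> carrier G \<Longrightarrow> commutator G x x = \<one>"
  by (simp add: commutator_def m_assoc)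

lemma commutator_eq_one_iff:
  assumes "x \<in> carrier G" "y \<in> carrier G"
  shows "commutator G x y = \<one> \<longleftrightarrow> x \<otimes> y = y \<otimes> x"
proof -
  have "commutator G x y = inv (y \<otimes> x) \<otimes> (x \<otimes> y)"
    using assms by (simp add: commutator_def m_assoc inv_mult_group)
  moreover have "inv (y \<otimes> x) \<otimes> (x \<otimes> y) = \<one> \<longleftrightarrow> x \<otimes> y = y \<otimes> x"
    using assms by (metis inv_solve_left m_closed one_closed r_one)
  ultimately show ?thesis by simp
qed

text \<open>These two identities are the defining relations of the tensor square read in \<open>G\<close>; they are the
  reason why sending a symbol to its commutator respects the relations.\<close>

lemma commutator_mult_left:
  assumes "x \<in> carrier G" "y \<in> carrier G" "z \<in> carrier G"
  shows "commutator G (x \<otimes> y) z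
           = commutator G (conjugate G x y) (conjugate G z y) \<otimes> commutator G y z"
  using assms by (simp add: commutator_def conjugate_def m_assoc inv_mult_group)

lemma commutator_mult_right:
  assumes "y \<in> carrier G" "t \<in> carrier G" "z \<in> carrier G"
  shows "commutator G y (t \<otimes> z)
           = commutator G y z \<otimes> commutator G (conjugate G y z) (conjugate G t z)"
  using assms by (simp add: commutator_def conjugate_def m_assoc inv_mult_group)

lemma nil_twords [simp]: "[] \<in> twords G" by (simp add: twords_def)

lemma append_twords [simp]: "u @ v \<in> twords G \<longleftrightarrow> u \<in> twords G \<and> v \<in> twords G"
  by (auto simp: twords_def)

lemma Cons_twords [simp]:
  "(x, y, b) # w \<in> twords G \<longleftrightarrow> x \<in> carrier G \<and> y \<in> carrier G \<and> w \<in> twords G"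
  by (auto simp: twords_def)

lemma tcong_twords: "tcong G N M u v \<Longrightarrow> u \<in> twords G \<and> v \<in> twords G"
  by (induction rule: tcong.induct) auto

definition inv_word :: "'a tword \<Rightarrow> 'a tword" where
  "inv_word w = rev (map (\<lambda>(x, y, b). (x, y, \<not> b)) w)"

lemma inv_word_simps [simp]:
  "inv_word [] = []" "inv_word ((x, y, b) # w) = inv_word w @ [(x, y, \<not> b)]"
  "inv_word (u @ v) = inv_word v @ inv_word u"
  by (simp_all add: inv_word_def)

lemma inv_word_inv_word [simp]: "inv_word (inv_word w) = w"
  by (induction w) auto

lemma inv_word_twords [simp]: "inv_word w \<in> twords G \<longleftrightarrow> w \<in> twords G"
  by (induction w) auto

lemma tcong_inv_word_right: "w \<in> twords G \<Longrightarrow> tcong G N M (w @ inv_word w) []"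
proof (induction w)
  case (Cons a w)
  obtain x y b where a: "a = (x, y, b)" by (cases a)
  with Cons have xy: "x \<in> carrier G" "y \<in> carrier G" and w: "w \<in> twords G" by auto
  have "tcong G N M (([(x, y, b)] @ w @ inv_word w) @ [(x, y, \<not> b)]) (([(x, y, b)] @ []) @ [(x, y,
      \<not> b)])"
    by (intro tcong.append tcong.refl Cons.IH w) (use xy in auto)
  then show ?case
    using tcong.trans [OF _ tcong.cancel [OF xy]] by (simp add: a)
qed (simp add: tcong.refl)

lemma tcong_inv_word_left: "w \<in> twords G \<Longrightarrow> tcong G N M (inv_word w @ w) []"
  using tcong_inv_word_right [of "inv_word w"] by simp

lemma tcong_append_left: "tcong G N M u v \<Longrightarrow> w \<in> twords G \<Longrightarrow> tcong G N M (w @ u) (w @ v)"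
  by (intro tcong.append tcong.refl)

lemma tcong_append_right: "tcong G N M u v \<Longrightarrow> w \<in> twords G \<Longrightarrow> tcong G N M (u @ w) (v @ w)"
  by (intro tcong.append tcong.refl)

lemma tcong_insert_cancelling_word:
  assumes "u \<in> twords G" "w \<in> twords G" "v \<in> twords G"
  shows "tcong G N M (u @ inv_word w @ w @ v) (u @ v)" "tcong G N M (u @ w @ inv_word w @ v) (u @
      v)"
  using tcong_append_left [OF tcong_append_right [OF tcong_inv_word_left [of w N M] assms(3)]
      assms(1)]
    tcong_append_left [OF tcong_append_right [OF tcong_inv_word_right [of w N M] assms(3)] assms(1)]
    assms by simp_all

text \<open>A coarser level identifies more symbols and keeps all other relations.\<close>

lemma tcong_mono:
  assumes "tcong G N M u v" "subgroup N G" "subgroup M G" "subgroup N' G" "subgroup M' G"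
    and "N \<subseteq> N'" "M \<subseteq> M'"
  shows "tcong G N' M' u v"
  using assms(1)
proof (induction rule: tcong.induct)
  case (sym u v)
  show ?case using sym.IH by (rule tcong.sym)
next
  case (trans u v w)
  show ?case using trans.IH by (rule tcong.trans)
next
  case (coset x x' y y')
  then have "x \<in> N #> x'" "y \<in> M #> y'"
    using assms(2,3) rcos_self [of x N] rcos_self [of y M] by auto
  then have "x \<in> N' #> x'" "y \<in> M' #> y'"
    using assms(6,7) unfolding r_coset_def by blast+
  then have "N' #> x = N' #> x'" "M' #> y = M' #> y'"
    using coset assms(4,5) repr_independence by auto
  with coset show ?case by (auto intro: tcong.coset)
qed (auto intro: tcong.refl tcong.append tcong.cancel tcong.mult_left tcong.mult_right)

definition tclass :: "'a set \<Rightarrow> 'a set \<Rightarrow> 'a tword \<Rightarrow> 'a tword set" where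
  "tclass N M w = {u. tcong G N M u w}"

lemma tclass_eq_iff:
  assumes "u \<in> twords G"
  shows "tclass N M u = tclass N M v \<longleftrightarrow> tcong G N M u v"
  using assms unfolding tclass_def by (blast intro: tcong.refl tcong.sym tcong.trans)

lemma tclass_self [simp]: "w \<in> twords G \<Longrightarrow> w \<in> tclass N M w"
  by (simp add: tclass_def tcong.refl)

lemma carrier_quotient_tensor: "carrier (quotient_tensor G N M) = tclass N M ` twords G"
proof -
  have "{(u, v). tcong G N M u v} `` {w} = tclass N M w" for w
    by (auto simp: tclass_def intro: tcong.sym)
  then show ?thesis by (auto simp: quotient_tensor_def quotient_def)
qed

lemma mult_quotient_tensor:
  assumes "u \<in> twords G" "v \<in> twords G"
  shows "tclass N M u \<otimes>\<^bsub>quotient_tensor G N M\<^esub> tclass N M v = tclass N M (u @ v)"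
proof -
  have "tcong G N M w (u @ v)" if "tcong G N M w (u' @ v')" "tcong G N M u' u" "tcong G N M v' v"
      for w u' v'
    using that by (blast intro: tcong.trans tcong.append)
  then show ?thesis
    using assms by (auto simp: quotient_tensor_def tclass_def intro: tcong.refl)
qed

lemma one_quotient_tensor: "\<one>\<^bsub>quotient_tensor G N M\<^esub> = tclass N M []"
  by (simp add: quotient_tensor_def tclass_def)

lemma group_quotient_tensor: "group (quotient_tensor G N M)"
proof (rule groupI)
  fix X assume "X \<in> carrier (quotient_tensor G N M)"
  then obtain w where w: "w \<in> twords G" "X = tclass N M w" by (auto simp: carrier_quotient_tensor)
  show "\<exists>Y\<in>carrier (quotient_tensor G N M). Y \<otimes>\<^bsub>quotient_tensor G N M\<^esub> X = \<one>\<^bsub>quotient_tensor G N M\<^esub>"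
    using w tcong_inv_word_left [of w N M]
    by (intro bexI [of _ "tclass N M (inv_word w)"])
       (auto simp: mult_quotient_tensor one_quotient_tensor carrier_quotient_tensor tclass_eq_iff)
qed (auto simp: carrier_quotient_tensor mult_quotient_tensor one_quotient_tensor)

lemma inv_quotient_tensor:
  assumes "w \<in> twords G"
  shows "inv\<^bsub>quotient_tensor G N M\<^esub> tclass N M w = tclass N M (inv_word w)"
  using assms tcong_inv_word_left [of w N M]
  by (intro group.inv_equality group_quotient_tensor)
     (auto simp: mult_quotient_tensor one_quotient_tensor carrier_quotient_tensor tclass_eq_iff)

text \<open>The action of \<open>G\<close> on the tensor square, \<open>(x \<otimes> y)\<^sup>z = x\<^sup>z \<otimes> y\<^sup>z\<close>.\<close>

definition conj_word :: "'a \<Rightarrow> 'a tword \<Rightarrow> 'a tword" where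
  "conj_word z = map (\<lambda>(x, y, b). (conjugate G x z, conjugate G y z, b))"

lemma conj_word_simps [simp]:
  "conj_word z [] = []"
  "conj_word z ((x, y, b) # w) = (conjugate G x z, conjugate G y z, b) # conj_word z w"
  "conj_word z (u @ v) = conj_word z u @ conj_word z v"
  by (simp_all add: conj_word_def)

lemma conj_word_twords [simp]: "w \<in> twords G \<Longrightarrow> z \<in> carrier G \<Longrightarrow> conj_word z w \<in> twords G"
  by (induction w) auto

text \<open>The words that represent the elements of the subgroup generated by the symbols \<open>x \<otimes> x\<close>.\<close>

definition diag_words :: "'a tword set" where
  "diag_words = lists {(x, x, b) |x b. x \<in> carrier G}"

lemma diag_words_simps [simp]:
  "[] \<in> diag_words"
  "(x, y, b) # w \<in> diag_words \<longleftrightarrow> x \<in> carrier G \<and> y = x \<and> w \<in> diag_words"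
  "u @ v \<in> diag_words \<longleftrightarrow> u \<in> diag_words \<and> v \<in> diag_words"
  by (auto simp: diag_words_def)

lemma diag_words_twords: "w \<in> diag_words \<Longrightarrow> w \<in> twords G"
  by (induction w) auto

lemma inv_word_diag_words [simp]: "inv_word w \<in> diag_words \<longleftrightarrow> w \<in> diag_words"
  by (induction w) auto

lemma conj_word_diag_words [simp]: "w \<in> diag_words \<Longrightarrow> z \<in> carrier G \<Longrightarrow> conj_word z w \<in> diag_words"
  by (induction w) auto

lemma tword_commutator_simps [simp]:
  "tword_commutator G [] = \<one>"
  "tword_commutator G ((x, y, b) # w) =
     (if b then commutator G x y else inv (commutator G x y)) \<otimes> tword_commutator G w"
  by (simp_all add: tword_commutator_def)

lemma tword_commutator_closed [simp]: "w \<in> twords G \<Longrightarrow> tword_commutator G w \<in> carrier G"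
  by (induction w) auto

lemma tword_commutator_append [simp]:
  "u \<in> twords G \<Longrightarrow> v \<in> twords G \<Longrightarrow>
    tword_commutator G (u @ v) = tword_commutator G u \<otimes> tword_commutator G v"
  by (induction u) (auto simp: m_assoc)

lemma tword_commutator_diag_words: "w \<in> diag_words \<Longrightarrow> tword_commutator G w = \<one>"
  by (induction w) auto

end

section \<open>The exterior square of a quotient\<close>

context normal
begin

lemma r_coset_group_hom: "group_hom G (G Mod H) (\<lambda>a. H #> a)"
  by (simp add: group_hom_axioms_def group_hom_def is_group factorgroup_is_group r_coset_hom_Mod)

lemma r_coset_eq_conjugate:
  assumes "x \<in> carrier G" "x' \<in> carrier G" "z \<in> carrier G" "H #> x = H #> x'"
  shows "H #> conjugate G x z = H #> conjugate G x' z"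
proof -
  interpret q: group_hom G "G Mod H" "\<lambda>a. H #> a" by (rule r_coset_group_hom)
  show ?thesis using assms by (simp add: conjugate_def del: mult_FactGroup)
qed

lemma r_coset_eq_commutator:
  assumes "x \<in> carrier G" "x' \<in> carrier G" "y \<in> carrier G" "y' \<in> carrier G"
    and "H #> x = H #> x'" "H #> y = H #> y'"
  shows "H #> commutator G x y = H #> commutator G x' y'"
proof -
  interpret q: group_hom G "G Mod H" "\<lambda>a. H #> a" by (rule r_coset_group_hom)
  show ?thesis using assms by (simp add: commutator_def del: mult_FactGroup)
qed

lemma r_coset_eq_mult:
  assumes "x \<in> carrier G" "x' \<in> carrier G" "y \<in> carrier G" "y' \<in> carrier G"
    and "H #> x = H #> x'" "H #> y = H #> y'"
  shows "H #> (x \<otimes> y) = H #> (x' \<otimes> y')"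
proof -
  interpret q: group_hom G "G Mod H" "\<lambda>a. H #> a" by (rule r_coset_group_hom)
  show ?thesis using assms by (simp del: mult_FactGroup)
qed

lemma r_coset_eq_iff_mem:
  assumes "x \<in> carrier G"
  shows "H #> x = H \<longleftrightarrow> x \<in> H"
  using assms coset_join1 coset_join2 subgroup_axioms by blast

lemma tcong_conj_word:
  "tcong G H H u v \<Longrightarrow> z \<in> carrier G \<Longrightarrow> tcong G H H (conj_word z u) (conj_word z v)"
proof (induction rule: tcong.induct)
  case (mult_left x y t)
  then show ?case
    using tcong.mult_left [of "conjugate G x z" G "conjugate G y z" "conjugate G t z" H H]
    by (simp add: conjugate_mult conjugate_conjugate)
next
  case (mult_right y s t)
  then show ?case
    using tcong.mult_right [of "conjugate G y z" G "conjugate G s z" "conjugate G t z" H H]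
    by (simp add: conjugate_mult conjugate_conjugate)
next
  case (coset x x' y y')
  then show ?case by (simp add: tcong.coset r_coset_eq_conjugate [of x x' z] r_coset_eq_conjugate
      [of y y' z])
next
  case (sym u v)
  show ?case using sym.IH [OF sym.prems] by (rule tcong.sym)
next
  case (trans u v w)
  show ?case using trans.IH(1) [OF trans.prems] trans.IH(2) [OF trans.prems] by (rule tcong.trans)
qed (auto intro: tcong.refl tcong.append tcong.cancel)

lemma tcong_tword_commutator:
  "tcong G H H u v \<Longrightarrow> H #> tword_commutator G u = H #> tword_commutator G v"
proof (induction rule: tcong.induct)
  case (append u u' v v')
  then have "u \<in> twords G" "u' \<in> twords G" "v \<in> twords G" "v' \<in> twords G"
    using tcong_twords by auto
  with append show ?case
    using r_coset_eq_mult [of "tword_commutator G u" "tword_commutator G u'" "tword_commutator G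
        v" "tword_commutator G v'"]
    by simp
next
  case (cancel x y b)
  then show ?case by (cases b) simp_all
next
  case (coset x x' y y')
  then show ?case using r_coset_eq_commutator [of x x' y y'] by simp
qed (simp_all add: commutator_mult_left commutator_mult_right)

text \<open>Equality of right cosets of the image of \<open>\<nabla>\<close> in the tensor square of \<open>G / H\<close>, that is, equality in
  the exterior square.\<close>

definition econg :: "'a tword \<Rightarrow> 'a tword \<Rightarrow> bool" where
  "econg u v \<longleftrightarrow> (\<exists>n\<in>diag_words. tcong G H H u (n @ v))"

lemma econg_twords: "econg u v \<Longrightarrow> u \<in> twords G \<and> v \<in> twords G"
  unfolding econg_def using tcong_twords by force

lemma tcong_imp_econg: "tcong G H H u v \<Longrightarrow> econg u v"
  unfolding econg_def by (rule bexI [of _ "[]"]) auto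

lemma econg_refl: "u \<in> twords G \<Longrightarrow> econg u u"
  by (simp add: tcong_imp_econg tcong.refl)

lemma econg_trans:
  assumes "econg u v" "econg v w" shows "econg u w"
proof -
  obtain n m where n: "n \<in> diag_words" "tcong G H H u (n @ v)"
    and m: "m \<in> diag_words" "tcong G H H v (m @ w)"
    using assms by (auto simp: econg_def)
  have "tcong G H H u (n @ m @ w)"
    using n m by (blast intro: tcong.trans tcong_append_left diag_words_twords)
  then show ?thesis
    unfolding econg_def by (intro bexI [of _ "n @ m"]) (use n m in auto)
qed

lemmas [trans] = econg_trans

lemma econg_sym:
  assumes "econg u v" shows "econg v u"
proof -
  obtain n where n: "n \<in> diag_words" "tcong G H H u (n @ v)"
    using assms by (auto simp: econg_def)
  then have tw: "n \<in> twords G" "v \<in> twords G"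
    using tcong_twords [OF n(2)] by auto
  have "tcong G H H (inv_word n @ u) (inv_word n @ n @ v)"
    using n tw by (intro tcong_append_left) auto
  moreover have "tcong G H H (inv_word n @ n @ v) v"
    using tcong_insert_cancelling_word(1) [of "[]" n v H H] tw by simp
  ultimately have "tcong G H H v (inv_word n @ u)" by (blast intro: tcong.trans tcong.sym)
  then show ?thesis
    unfolding econg_def by (intro bexI [of _ "inv_word n"]) (use n in auto)
qed

lemma econg_append_right:
  assumes "econg u v" "w \<in> twords G" shows "econg (u @ w) (v @ w)"
  using assms tcong_append_right unfolding econg_def by fastforce

lemma econg_cancel_right:
  assumes "econg (u @ w) (v @ w)" shows "econg u v"
proof -
  have tw: "u \<in> twords G" "w \<in> twords G" "v \<in> twords G" using econg_twords [OF assms] by auto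
  have "econg (u @ w @ inv_word w) (v @ w @ inv_word w)"
    using econg_append_right [OF assms, of "inv_word w"] tw by simp
  moreover have "econg (u @ w @ inv_word w) u" "econg (v @ w @ inv_word w) v"
    using tcong_insert_cancelling_word(2) [of u w "[]" H H] tcong_insert_cancelling_word(2) [of v
        w "[]" H H] tw
    by (auto intro: tcong_imp_econg)
  ultimately show ?thesis by (blast intro: econg_trans econg_sym)
qed

lemma econg_append_nil:
  assumes "econg u []" "v \<in> twords G" shows "econg (u @ v) v"
  using econg_append_right [OF assms] by simp

lemma econg_conj_word:
  assumes "econg u v" "z \<in> carrier G" shows "econg (conj_word z u) (conj_word z v)"
proof -
  obtain n where n: "n \<in> diag_words" "tcong G H H u (n @ v)"
    using assms by (auto simp: econg_def)
  then have "tcong G H H (conj_word z u) (conj_word z n @ conj_word z v)"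
    using tcong_conj_word [OF n(2) assms(2)] by simp
  then show ?thesis unfolding econg_def using n assms(2) by (meson conj_word_diag_words)
qed

lemma econg_tword_commutator:
  assumes "econg u v" shows "H #> tword_commutator G u = H #> tword_commutator G v"
proof -
  obtain n where n: "n \<in> diag_words" "tcong G H H u (n @ v)"
    using assms by (auto simp: econg_def)
  moreover have "v \<in> twords G" using econg_twords [OF assms] by simp
  ultimately show ?thesis
    using tcong_tword_commutator [OF n(2)]
    by (simp add: tword_commutator_diag_words diag_words_twords)
qed

definition wedge_trivial :: "'a \<Rightarrow> 'a \<Rightarrow> bool" where
  "wedge_trivial x y \<longleftrightarrow> econg [(x, y, True)] []"

lemma wedge_trivial_carrier: "wedge_trivial x y \<Longrightarrow> x \<in> carrier G \<and> y \<in> carrier G"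
  unfolding wedge_trivial_def using econg_twords by fastforce

lemma wedge_trivial_conjugate:
  assumes "wedge_trivial x y" "z \<in> carrier G"
  shows "wedge_trivial (conjugate G x z) (conjugate G y z)"
  using econg_conj_word [of "[(x, y, True)]" "[]" z] assms by (simp add: wedge_trivial_def)

lemma wedge_trivial_of_conjugate:
  assumes "wedge_trivial (conjugate G x z) (conjugate G y z)"
    "x \<in> carrier G" "y \<in> carrier G" "z \<in> carrier G"
  shows "wedge_trivial x y"
  using wedge_trivial_conjugate [OF assms(1), of "inv z"] assms(2-) by simp

text \<open>The first relation reads \<open>ty \<and> z = (t\<^sup>y \<and> z\<^sup>y) (y \<and> z)\<close>, and \<open>t\<^sup>y \<and> z\<^sup>y\<close> is trivial if and only if
  \<open>t \<and> z\<close> is, since conjugation by \<open>y\<close> is invertible. Hence two elements have the same wedge with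
  \<open>z\<close> exactly when they lie in the same right coset of the exterior centralizer of \<open>z\<close>.\<close>

lemma econg_mult_left_iff:
  assumes "t \<in> carrier G" "y \<in> carrier G" "z \<in> carrier G"
  shows "econg [(t \<otimes> y, z, True)] [(y, z, True)] \<longleftrightarrow> wedge_trivial t z"
proof -
  have rel: "econg [(t \<otimes> y, z, True)] ([(conjugate G t y, conjugate G z y, True)] @ [(y, z, True)])"
    using tcong.mult_left [OF assms] by (simp add: tcong_imp_econg)
  show ?thesis
  proof
    assume "econg [(t \<otimes> y, z, True)] [(y, z, True)]"
    then have "econg ([(conjugate G t y, conjugate G z y, True)] @ [(y, z, True)]) ([] @ [(y, z,
        True)])"
      using econg_trans [OF econg_sym [OF rel]] by simp
    then have "wedge_trivial (conjugate G t y) (conjugate G z y)"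
      unfolding wedge_trivial_def by (rule econg_cancel_right)
    then show "wedge_trivial t z" using assms by (blast intro: wedge_trivial_of_conjugate)
  next
    assume "wedge_trivial t z"
    then have "wedge_trivial (conjugate G t y) (conjugate G z y)"
      using assms by (auto intro: wedge_trivial_conjugate)
    then have "econg ([(conjugate G t y, conjugate G z y, True)] @ [(y, z, True)]) [(y, z, True)]"
      unfolding wedge_trivial_def using assms by (intro econg_append_nil) auto
    then show "econg [(t \<otimes> y, z, True)] [(y, z, True)]" using rel by (blast intro: econg_trans)
  qed
qed

lemma wedge_trivial_one_left:
  assumes "z \<in> carrier G" shows "wedge_trivial \<one> z"
  using econg_mult_left_iff [of \<one> \<one> z] assms by (simp add: econg_refl)

lemma wedge_trivial_mult_left:
  assumes "wedge_trivial x z" "wedge_trivial y z" shows "wedge_trivial (x \<otimes> y) z"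
  using econg_mult_left_iff [of x y z] wedge_trivial_carrier assms econg_trans
  unfolding wedge_trivial_def by blast

lemma wedge_trivial_inv_left:
  assumes "wedge_trivial x z" shows "wedge_trivial (inv x) z"
proof -
  have xz: "x \<in> carrier G" "z \<in> carrier G" using wedge_trivial_carrier assms by auto
  have "econg [(\<one>, z, True)] [(inv x, z, True)]"
    using econg_mult_left_iff [of x "inv x" z] assms xz by simp
  then show ?thesis
    using wedge_trivial_one_left [OF xz(2)] econg_trans econg_sym unfolding wedge_trivial_def
      by blast
qed

lemma subgroup_wedge_trivial:
  assumes "z \<in> carrier G" shows "subgroup {x. wedge_trivial x z} G"
  using assms wedge_trivial_carrier wedge_trivial_one_left
  by (intro subgroupI) (auto intro: wedge_trivial_mult_left wedge_trivial_inv_left)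

text \<open>With \<open>a = x\<^sup>y\<close>, expanding by both relations gives \<open>xy \<otimes> xy = (a \<otimes> y) (a\<^sup>y \<otimes> a\<^sup>y) (y \<otimes> y) (y \<otimes> a)\<close>.
  The left side and the two middle symbols lie in \<open>\<nabla>\<close>, so \<open>y \<and> a\<close> is trivial as soon as \<open>a \<and> y\<close>
  is.\<close>

lemma wedge_trivial_commute:
  assumes "wedge_trivial a y" shows "wedge_trivial y a"
proof -
  have ay [simp]: "a \<in> carrier G" "y \<in> carrier G" using wedge_trivial_carrier assms by auto
  define x where "x = conjugate G a (inv y)"
  have x [simp]: "x \<in> carrier G" and xa: "conjugate G x y = a" by (simp_all add: x_def)
  let ?T = "tcong G H H"
  have 1: "?T [(x \<otimes> y, x \<otimes> y, True)] ([(a, a \<otimes> y, True)] @ [(y, x \<otimes> y, True)])"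
    using tcong.mult_left [of x G y "x \<otimes> y"] by (simp add: xa conjugate_mult)
  have 2: "?T [(a, a \<otimes> y, True)] [(a, y, True), (conjugate G a y, conjugate G a y, True)]"
    using tcong.mult_right [of a G a y] by simp
  have 3: "?T [(y, x \<otimes> y, True)] [(y, y, True), (y, a, True)]"
    using tcong.mult_right [of y G x y] by (simp add: xa)
  let ?n = "[(conjugate G a y, conjugate G a y, True), (y, y, True)]"
  have expand: "econg [(x \<otimes> y, x \<otimes> y, True)] ([(a, y, True)] @ ?n @ [(y, a, True)])"
    using tcong.trans [OF 1 tcong.append [OF 2 3]] by (simp add: tcong_imp_econg)
  have diag: "econg n []" if "n \<in> diag_words" for n
    unfolding econg_def using that
    by (intro bexI [of _ n]) (auto intro: tcong.refl diag_words_twords)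
  have "econg [] [(x \<otimes> y, x \<otimes> y, True)]"
    by (rule econg_sym [OF diag]) auto
  also note expand
  also have "econg ([(a, y, True)] @ ?n @ [(y, a, True)]) (?n @ [(y, a, True)])"
    using assms unfolding wedge_trivial_def by (intro econg_append_nil) auto
  also have "econg (?n @ [(y, a, True)]) [(y, a, True)]"
    by (intro econg_append_nil diag) auto
  finally show ?thesis unfolding wedge_trivial_def by (rule econg_sym)
qed

lemma wedge_trivial_sym: "wedge_trivial x y \<longleftrightarrow> wedge_trivial y x"
  using wedge_trivial_commute by blast

lemma econg_symbol_coset:
  assumes "x \<in> carrier G" "x' \<in> carrier G" "y \<in> carrier G" "y' \<in> carrier G"
    and "H #> x = H #> x'" "H #> y = H #> y'"
  shows "econg [(x, y, True)] [(x', y', True)]"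
  using assms by (intro tcong_imp_econg tcong.coset)

lemma wedge_trivial_coset:
  assumes "x \<in> carrier G" "x' \<in> carrier G" "y \<in> carrier G" "y' \<in> carrier G"
    and "H #> x = H #> x'" "H #> y = H #> y'"
  shows "wedge_trivial x y \<longleftrightarrow> wedge_trivial x' y'"
  using econg_symbol_coset [OF assms] unfolding wedge_trivial_def by (meson econg_trans econg_sym)

lemma wedge_trivial_imp_commutator_mem:
  assumes "wedge_trivial x y" shows "commutator G x y \<in> H"
proof -
  have "x \<in> carrier G" "y \<in> carrier G" using wedge_trivial_carrier assms by auto
  then show ?thesis
    using econg_tword_commutator [OF assms [unfolded wedge_trivial_def]] r_coset_eq_iff_mem
    by (simp add: coset_mult_one subset)
qed

end

lemma group_commute_mult_inv:
  assumes "group Q" "x \<in> carrier Q" "y \<in> carrier Q" "z \<in> carrier Q"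
    and "x \<otimes>\<^bsub>Q\<^esub> z = z \<otimes>\<^bsub>Q\<^esub> x" "y \<otimes>\<^bsub>Q\<^esub> z = z \<otimes>\<^bsub>Q\<^esub> y"
  shows "(x \<otimes>\<^bsub>Q\<^esub> inv\<^bsub>Q\<^esub> y) \<otimes>\<^bsub>Q\<^esub> z = z \<otimes>\<^bsub>Q\<^esub> (x \<otimes>\<^bsub>Q\<^esub> inv\<^bsub>Q\<^esub> y)"
proof -
  interpret group Q by fact
  note c = assms(2-4)
  have "inv\<^bsub>Q\<^esub> y \<otimes>\<^bsub>Q\<^esub> z = inv\<^bsub>Q\<^esub> y \<otimes>\<^bsub>Q\<^esub> (z \<otimes>\<^bsub>Q\<^esub> y) \<otimes>\<^bsub>Q\<^esub> inv\<^bsub>Q\<^esub> y"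
    using c by (simp add: m_assoc)
  also have "\<dots> = z \<otimes>\<^bsub>Q\<^esub> inv\<^bsub>Q\<^esub> y"
    unfolding assms(6) [symmetric] using c by (simp add: m_assoc)
  finally have "x \<otimes>\<^bsub>Q\<^esub> (inv\<^bsub>Q\<^esub> y \<otimes>\<^bsub>Q\<^esub> z) = (x \<otimes>\<^bsub>Q\<^esub> z) \<otimes>\<^bsub>Q\<^esub> inv\<^bsub>Q\<^esub> y"
    using c by (simp add: m_assoc)
  then show ?thesis unfolding assms(5) using c by (simp add: m_assoc)
qed

context normal
begin

lemma commutator_mem_iff:
  assumes "x \<in> carrier G" "z \<in> carrier G"
  shows "commutator G x z \<in> H \<longleftrightarrow> (H #> x) \<otimes>\<^bsub>G Mod H\<^esub> (H #> z) = (H #> z) \<otimes>\<^bsub>G Mod H\<^esub> (H #> x)"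
proof -
  interpret q: group_hom G "G Mod H" "\<lambda>a. H #> a" by (rule r_coset_group_hom)
  have "H #> commutator G x z = commutator (G Mod H) (H #> x) (H #> z)"
    using assms by (simp add: commutator_def del: mult_FactGroup)
  moreover have "commutator G x z \<in> H \<longleftrightarrow> H #> commutator G x z = \<one>\<^bsub>G Mod H\<^esub>"
    using r_coset_eq_iff_mem [of "commutator G x z"] assms by simp
  ultimately show ?thesis
    using group.commutator_eq_one_iff [OF factorgroup_is_group q.hom_closed [OF assms(1)]
        q.hom_closed [OF assms(2)]]
    by (simp only:)
qed

lemma commutator_mem_sym:
  assumes "x \<in> carrier G" "z \<in> carrier G"
  shows "commutator G x z \<in> H \<longleftrightarrow> commutator G z x \<in> H"
  unfolding commutator_mem_iff [OF assms] commutator_mem_iff [OF assms(2,1)] by (rule eq_commute)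

lemma commutator_mem_coset:
  assumes "x \<in> carrier G" "x' \<in> carrier G" "y \<in> carrier G" "y' \<in> carrier G"
    and "H #> x = H #> x'" "H #> y = H #> y'"
  shows "commutator G x y \<in> H \<longleftrightarrow> commutator G x' y' \<in> H"
  using assms by (simp add: commutator_mem_iff)

lemma commutator_mem_mult_inv:
  assumes "x \<in> carrier G" "y \<in> carrier G" "z \<in> carrier G"
    and "commutator G x z \<in> H" "commutator G y z \<in> H"
  shows "commutator G (x \<otimes> inv y) z \<in> H"
proof -
  interpret q: group_hom G "G Mod H" "\<lambda>a. H #> a" by (rule r_coset_group_hom)
  have "H #> (x \<otimes> inv y) = (H #> x) \<otimes>\<^bsub>G Mod H\<^esub> inv\<^bsub>G Mod H\<^esub> (H #> y)"
    using assms by (simp del: mult_FactGroup)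
  then show ?thesis
    using group_commute_mult_inv [OF factorgroup_is_group q.hom_closed q.hom_closed q.hom_closed,
        of x y z] assms
    by (simp add: commutator_mem_iff del: mult_FactGroup)
qed

lemma econg_mono:
  assumes "econg u v" "M \<lhd> G" "H \<subseteq> M" shows "normal.econg M G u v"
proof -
  interpret M: normal M G by fact
  obtain n where n: "n \<in> diag_words" "tcong G H H u (n @ v)"
    using assms(1) unfolding econg_def by (elim bexE) (rule that)
  have "tcong G M M u (n @ v)"
    by (rule tcong_mono [OF n(2)]) (simp_all add: subgroup_axioms M.subgroup_axioms assms(3))
  then show ?thesis unfolding M.econg_def using n(1) by (rule bexI)
qed

lemma wedge_trivial_mono:
  assumes "wedge_trivial x y" "M \<lhd> G" "H \<subseteq> M" shows "normal.wedge_trivial M G x y"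
proof -
  interpret M: normal M G by fact
  show ?thesis using econg_mono assms unfolding wedge_trivial_def M.wedge_trivial_def .
qed

end

section \<open>Pro-p-groups as limits of finite p-groups\<close>

locale pro_p = group G for G :: "('a, 'm) monoid_scheme" (structure) +
  fixes p :: nat and T :: "'a topology"
  assumes prime_p: "prime p" and pro_p: "pro_p_group p G T"
begin

abbreviation P :: "'a set set" where
  "P \<equiv> p_quotients p G T"

lemma topspace_T [simp]: "topspace T = carrier G"
  using pro_p by (simp add: pro_p_group_def topological_group_def)

lemma P_normal: "N \<in> P \<Longrightarrow> N \<lhd> G"
  by (simp add: p_quotients_def)

lemma P_subgroup: "N \<in> P \<Longrightarrow> subgroup N G"
  using P_normal normal_imp_subgroup by blast

lemma P_rcosets_finite: "N \<in> P \<Longrightarrow> finite (rcosets N)"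
  by (simp add: p_quotients_def FactGroup_def)

lemma carrier_in_P: "carrier G \<in> P"
proof -
  have "carrier G \<lhd> G" by (intro normalI) (auto simp: subgroup_self coset_join2 coset_join3)
  moreover have "rcosets (carrier G) = {carrier G}"
    by (auto simp: RCOSETS_def coset_join2 subgroup_self)
  moreover have "closedin T (carrier G)" using closedin_topspace [of T] by simp
  ultimately show ?thesis
    by (auto simp: p_quotients_def FactGroup_def order_def intro: exI [of _ 0])
qed

text \<open>\<open>G / (N \<inter> M)\<close> embeds into \<open>G / N \<times> G / M\<close>, so by the theorem of Lagrange its order is a power of
  \<open>p\<close> again.\<close>

lemma P_Int:
  assumes "N \<in> P" "M \<in> P" shows "N \<inter> M \<in> P"
proof -
  let ?Q = "(G Mod N) \<times>\<times> (G Mod M)" and ?h = "\<lambda>a. (N #> a, M #> a)"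
  interpret N: normal N G by (rule P_normal [OF assms(1)])
  interpret M: normal M G by (rule P_normal [OF assms(2)])
  interpret QN: group_hom G "G Mod N" "\<lambda>a. N #> a" by (rule N.r_coset_group_hom)
  interpret QM: group_hom G "G Mod M" "\<lambda>a. M #> a" by (rule M.r_coset_group_hom)
  have grp: "group ?Q" by (intro DirProd_group N.factorgroup_is_group M.factorgroup_is_group)
  have hom: "?h \<in> hom G ?Q"
    using N.r_coset_hom_Mod M.r_coset_hom_Mod by (auto simp: hom_def Pi_def)
  interpret h: group_hom G ?Q ?h
    using grp hom by (simp add: group_hom_def group_hom_axioms_def is_group)
  define I where "I = ?Q\<lparr>carrier := ?h ` carrier G\<rparr>"
  have sub: "subgroup (?h ` carrier G) ?Q" by (rule h.img_is_subgroup)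
  have "?h \<in> hom G I" using h.hom_mult by (intro homI) (auto simp: I_def)
  moreover have "group I" unfolding I_def by (rule subgroup.subgroup_is_group [OF sub grp])
  ultimately interpret hI: group_hom G I ?h
    by (simp add: group_hom_def group_hom_axioms_def is_group)
  have "kernel G I ?h = N \<inter> M"
    using N.r_coset_eq_iff_mem M.r_coset_eq_iff_mem N.subset
    by (auto simp: kernel_def I_def)
  moreover have "?h ` carrier G = carrier I" by (simp add: I_def)
  ultimately have bij: "bij_betw (\<lambda>X. the_elem (?h ` X)) (carrier (G Mod (N \<inter> M))) (?h ` carrier G)"
    using hI.FactGroup_iso_set by (simp add: iso_def)
  have card: "order (G Mod (N \<inter> M)) = card (?h ` carrier G)"
    and fin: "finite (carrier (G Mod (N \<inter> M))) = finite (?h ` carrier G)"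
    using bij_betw_same_card [OF bij] bij_betw_finite [OF bij] by (simp_all only: order_def)
  obtain j k where jk: "order (G Mod N) = p ^ j" "order (G Mod M) = p ^ k"
    using assms by (auto simp: p_quotients_def)
  have "order ?Q = p ^ (j + k)" using jk by (simp add: order_def card_cartesian_product power_add)
  moreover have "card (?h ` carrier G) dvd order ?Q"
    unfolding group.lagrange [OF grp sub, symmetric] by (rule dvd_triv_right)
  ultimately have "card (?h ` carrier G) dvd p ^ (j + k)" by (simp only:)
  then have pow: "\<exists>l. card (?h ` carrier G) = p ^ l"
    unfolding divides_primepow_nat [OF prime_p] by blast
  have "finite (carrier ?Q)" using assms by (simp add: p_quotients_def)
  then have "finite (?h ` carrier G)" by (rule finite_subset [OF subgroup.subset [OF sub]])
  moreover have "N \<inter> M \<lhd> G" by (intro normal_subgroup_intersect P_normal assms)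
  moreover have "closedin T (N \<inter> M)" using assms
    by (intro closedin_Int) (simp_all add: p_quotients_def)
  ultimately show ?thesis using card fin pow by (simp add: p_quotients_def)
qed

lemma P_directed:
  assumes "finite \<F>" "\<F> \<subseteq> P" obtains K where "K \<in> P" "\<And>N. N \<in> \<F> \<Longrightarrow> K \<subseteq> N"
proof -
  have "\<exists>K\<in>P. \<forall>N\<in>\<F>. K \<subseteq> N"
    using assms
  proof (induction \<F>)
    case empty
    then show ?case using carrier_in_P by blast
  next
    case (insert N \<F>)
    then obtain K where "K \<in> P" "\<forall>M\<in>\<F>. K \<subseteq> M" by auto
    with insert show ?case by (intro bexI [of _ "N \<inter> K"]) (auto intro: P_Int)
  qed
  then show thesis using that by blast
qed

lemma coset_map_homeomorphic:
  "homeomorphic_map T (quotient_limit_topology p G T) (\<lambda>g. \<lambda>N\<in>P. N #> g)"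
  using pro_p by (simp add: pro_p_group_def)

lemma Inter_P: assumes "g \<in> carrier G" "\<And>N. N \<in> P \<Longrightarrow> g \<in> N" shows "g = \<one>"
proof -
  have "inj_on (\<lambda>g. \<lambda>N\<in>P. N #> g) (carrier G)"
    using coset_map_homeomorphic by (simp add: homeomorphic_map_def)
  moreover have "(\<lambda>N\<in>P. N #> g) = (\<lambda>N\<in>P. N #> \<one>)"
    using assms P_subgroup by (intro restrict_ext) (simp add: coset_join2 subgroup.one_closed)
  ultimately show ?thesis using assms by (auto simp: inj_on_def)
qed

lemma openin_r_coset:
  assumes "N \<in> P" "g \<in> carrier G" shows "openin T (N #> g)"
proof -
  have cont: "continuous_map T (product_topology (\<lambda>N. discrete_topology (carrier (G Mod N))) P)
      (\<lambda>g. \<lambda>N\<in>P. N #> g)"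
    using homeomorphic_imp_continuous_map [OF coset_map_homeomorphic]
    by (simp add: quotient_limit_topology_def continuous_map_in_subtopology)
  have "continuous_map T (discrete_topology (carrier (G Mod N))) (\<lambda>g. N #> g)"
    using continuous_map_compose [OF cont continuous_map_product_projection [OF assms(1)]] assms(1)
    by (simp add: o_def)
  then have "openin T {x \<in> topspace T. N #> x \<in> {N #> g}}"
    by (rule openin_continuous_map_preimage) (use assms in \<open>auto simp: carrier_FactGroup\<close>)
  moreover have "{x \<in> topspace T. N #> x \<in> {N #> g}} = N #> g"
  proof (intro equalityI subsetI)
    fix x assume "x \<in> {x \<in> topspace T. N #> x \<in> {N #> g}}"
    then show "x \<in> N #> g" using rcos_self [OF _ P_subgroup [OF assms(1)], of x] by simp
  next
    fix x assume x: "x \<in> N #> g"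
    then have "N #> g = N #> x" by (rule repr_independence [OF _ assms(2) P_subgroup [OF assms(1)]])
    moreover have "x \<in> carrier G"
      using subgroup.elemrcos_carrier [OF P_subgroup [OF assms(1)] is_group assms(2) x] .
    ultimately show "x \<in> {x \<in> topspace T. N #> x \<in> {N #> g}}" by simp
  qed
  ultimately show ?thesis by simp
qed

text \<open>The compatible families form a closed subset of a product of finite discrete spaces: a family
  fails to be compatible because of two of its coordinates, and those may be fixed.\<close>

lemma compact_T: "compact_space T"
proof -
  let ?X = "product_topology (\<lambda>N. discrete_topology (carrier (G Mod N))) P"
  let ?A = "\<lambda>N c. {f \<in> topspace ?X. f N \<in> {c}}"
  let ?B = "{?A N c \<inter> ?A M d | N M c d. N \<in> P \<and> M \<in> P \<and> N \<subseteq> M \<and> c \<in> carrier (G Mod N) \<and> d \<in>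
      carrier (G Mod M) \<and> \<not> c \<subseteq> d}"
  have "openin ?X (?A N c)" if "N \<in> P" "c \<in> carrier (G Mod N)" for N c
    by (rule openin_continuous_map_preimage [OF continuous_map_product_projection])
      (use that in auto)
  then have "openin ?X (\<Union>?B)" by (intro openin_Union) auto
  then have "closedin ?X (topspace ?X - \<Union>?B)" by (rule closedin_diff [OF closedin_topspace])
  moreover have "quotient_limit p G T = topspace ?X - \<Union>?B"
  proof (intro equalityI subsetI)
    fix f assume "f \<in> quotient_limit p G T"
    then show "f \<in> topspace ?X - \<Union>?B" unfolding quotient_limit_def by force
  next
    fix f assume f: "f \<in> topspace ?X - \<Union>?B"
    have "f N \<subseteq> f M" if "N \<in> P" "M \<in> P" "N \<subseteq> M" for N M
    proof (rule ccontr)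
      assume "\<not> f N \<subseteq> f M"
      moreover have "f N \<in> carrier (G Mod N)" "f M \<in> carrier (G Mod M)"
        using f that by (auto simp: PiE_iff)
      ultimately have "?A N (f N) \<inter> ?A M (f M) \<in> ?B" using that by blast
      moreover have "f \<in> ?A N (f N) \<inter> ?A M (f M)" using f by simp
      ultimately show False using f by blast
    qed
    then show "f \<in> quotient_limit p G T" using f by (simp add: quotient_limit_def)
  qed
  ultimately have "closedin ?X (quotient_limit p G T)" by (simp only:)
  moreover have "compact_space ?X"
    unfolding compact_space_product_topology
    by (rule disjI2) (simp add: compact_space_discrete_topology p_quotients_def)
  ultimately have "compact_space (quotient_limit_topology p G T)"
    unfolding quotient_limit_topology_def
      by (intro compact_space_subtopology closedin_compact_space)
  then show ?thesis
    using homeomorphic_compact_space homeomorphic_map_imp_homeomorphic_space [OF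
        coset_map_homeomorphic] by blast
qed

end

section \<open>Triviality in the complete exterior square\<close>

context pro_p begin
abbreviation CT where "CT \<equiv> complete_tensor p G T"

text \<open>The image of a word under the canonical map to the projective limit.\<close>

definition thread :: "'a tword \<Rightarrow> 'a set \<times> 'a set \<Rightarrow> 'a tword set" where
  "thread w = (\<lambda>(N, M)\<in>P \<times> P. tclass N M w)"

lemma thread_apply [simp]: "N \<in> P \<Longrightarrow> M \<in> P \<Longrightarrow> thread w (N, M) = tclass N M w"
  by (simp add: thread_def)

lemma tensor_symbol_eq_thread: "tensor_symbol p G T x y = thread [(x, y, True)]"
  by (simp add: tensor_symbol_def thread_def tclass_def)

abbreviation "full_product \<equiv> product_group (P \<times> P) (\<lambda>(N, M). quotient_tensor G N M)"

lemma group_full_product: "group full_product"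
  by (rule product_group) (auto simp: group_quotient_tensor)

lemma complete_tensor_eq: "CT = full_product\<lparr>carrier := carrier CT\<rparr>"
  by (simp add: complete_tensor_def Let_def)

lemma carrier_CT:
  "t \<in> carrier CT \<longleftrightarrow> t \<in> extensional (P \<times> P) \<and>
     (\<forall>N\<in>P. \<forall>M\<in>P. \<exists>w\<in>twords G. t (N, M) = tclass N M w) \<and>
     (\<forall>N\<in>P. \<forall>M\<in>P. \<forall>N'\<in>P. \<forall>M'\<in>P. N \<subseteq> N' \<longrightarrow> M \<subseteq> M' \<longrightarrow> t (N, M) \<subseteq> t (N', M'))"
  unfolding complete_tensor_def Let_def
  by (simp add: PiE_iff carrier_quotient_tensor image_iff) (rule conj_left_commute)

text \<open>Since the components of a family are compatible, a word representing it at level \<open>(K, K)\<close>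
  represents it at all coarser levels.\<close>

lemma CT_coarser_level:
  assumes "t \<in> carrier CT" "K \<in> P" "N \<in> P" "M \<in> P" "K \<subseteq> N" "K \<subseteq> M"
    and "t (K, K) = tclass K K w" "w \<in> twords G"
  shows "t (N, M) = tclass N M w"
proof -
  have "w \<in> t (K, K)" using assms by simp
  then have "w \<in> t (N, M)" using assms(1-6) unfolding carrier_CT by blast
  moreover obtain u where "u \<in> twords G" "t (N, M) = tclass N M u"
    using assms(1-4) unfolding carrier_CT by blast
  ultimately show ?thesis using assms(8) by (metis tclass_eq_iff tclass_def mem_Collect_eq)
qed

lemma CT_common_word:
  assumes "t \<in> carrier CT" "N \<in> P" "M \<in> P" "N' \<in> P" "M' \<in> P" "N \<subseteq> N'" "M \<subseteq> M'"
  obtains w where "w \<in> twords G" "t (N, M) = tclass N M w" "t (N', M') = tclass N' M' w"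
proof -
  obtain w where w: "w \<in> twords G" "t (N, M) = tclass N M w"
    using assms(1-3) unfolding carrier_CT by blast
  then have "w \<in> t (N, M)" by simp
  then have "w \<in> t (N', M')" using assms unfolding carrier_CT by blast
  moreover obtain u where "u \<in> twords G" "t (N', M') = tclass N' M' u"
    using assms unfolding carrier_CT by blast
  ultimately show thesis using that w by (metis tclass_eq_iff tclass_def mem_Collect_eq)
qed

lemma tclass_mono:
  assumes "N \<in> P" "M \<in> P" "N' \<in> P" "M' \<in> P" "N \<subseteq> N'" "M \<subseteq> M'"
  shows "tclass N M w \<subseteq> tclass N' M' w"
  using assms by (auto simp: tclass_def intro: tcong_mono P_subgroup)

lemma thread_in_CT [simp]: "w \<in> twords G \<Longrightarrow> thread w \<in> carrier CT"
  using tclass_mono by (auto simp: carrier_CT thread_def)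

lemma mult_CT_apply:
  "N \<in> P \<Longrightarrow> M \<in> P \<Longrightarrow> (s \<otimes>\<^bsub>CT\<^esub> t) (N, M) = s (N, M) \<otimes>\<^bsub>quotient_tensor G N M\<^esub> t (N, M)"
  by (subst complete_tensor_eq) simp

lemma inv_full_product_apply:
  "t \<in> carrier full_product \<Longrightarrow> N \<in> P \<Longrightarrow> M \<in> P \<Longrightarrow> (inv\<^bsub>full_product\<^esub> t) (N, M) = inv\<^bsub>quotient_tensor G
      N M\<^esub> t (N, M)"
  by (subst inv_product_group) (auto simp: group_quotient_tensor)

lemma subgroup_CT: "subgroup (carrier CT) full_product"
proof (rule group.subgroupI [OF group_full_product])
  show sub: "carrier CT \<subseteq> carrier full_product"
    by (auto simp: complete_tensor_def Let_def)
  have "thread [] \<in> carrier CT" by simp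
  then show "carrier CT \<noteq> {}" by blast
  fix s assume s: "s \<in> carrier CT"
  then have sD: "s \<in> carrier full_product" using sub by blast
  have inv: "(inv\<^bsub>full_product\<^esub> s) (N, M) = tclass N M (inv_word w)"
    if "N \<in> P" "M \<in> P" "w \<in> twords G" "s (N, M) = tclass N M w" for N M w
    using that sD by (simp add: inv_full_product_apply inv_quotient_tensor)
  show "inv\<^bsub>full_product\<^esub> s \<in> carrier CT"
    unfolding carrier_CT
  proof (intro conjI ballI impI)
    show "inv\<^bsub>full_product\<^esub> s \<in> extensional (P \<times> P)"
      using group.inv_closed [OF group_full_product sD] by (simp add: PiE_iff)
    show "\<exists>w\<in>twords G. (inv\<^bsub>full_product\<^esub> s) (N, M) = tclass N M w" if "N \<in> P" "M \<in> P" for N M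
      using s that inv unfolding carrier_CT by (metis inv_word_twords)
    show "(inv\<^bsub>full_product\<^esub> s) (N, M) \<subseteq> (inv\<^bsub>full_product\<^esub> s) (N', M')"
      if NM: "N \<in> P" "M \<in> P" "N' \<in> P" "M' \<in> P" "N \<subseteq> N'" "M \<subseteq> M'" for N M N' M'
      using CT_common_word [OF s NM] inv NM tclass_mono by metis
  qed
  fix t assume t: "t \<in> carrier CT"
  then have tD: "t \<in> carrier full_product" using sub by blast
  have mult: "(s \<otimes>\<^bsub>full_product\<^esub> t) (N, M) = tclass N M (u @ v)"
    if "N \<in> P" "M \<in> P" "u \<in> twords G" "v \<in> twords G" "s (N, M) = tclass N M u" "t (N, M) = tclass
        N M v" for N M u v
    using that by (simp add: mult_quotient_tensor)
  show "s \<otimes>\<^bsub>full_product\<^esub> t \<in> carrier CT"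
    unfolding carrier_CT
  proof (intro conjI ballI impI)
    show "s \<otimes>\<^bsub>full_product\<^esub> t \<in> extensional (P \<times> P)" by simp
    show "\<exists>w\<in>twords G. (s \<otimes>\<^bsub>full_product\<^esub> t) (N, M) = tclass N M w" if "N \<in> P" "M \<in> P" for N M
      using s t that mult unfolding carrier_CT by (metis append_twords)
    show "(s \<otimes>\<^bsub>full_product\<^esub> t) (N, M) \<subseteq> (s \<otimes>\<^bsub>full_product\<^esub> t) (N', M')"
      if NM: "N \<in> P" "M \<in> P" "N' \<in> P" "M' \<in> P" "N \<subseteq> N'" "M \<subseteq> M'" for N M N' M'
    proof -
      obtain u where u: "u \<in> twords G" "s (N, M) = tclass N M u" "s (N', M') = tclass N' M' u"
        using CT_common_word [OF s NM] .
      obtain v where v: "v \<in> twords G" "t (N, M) = tclass N M v" "t (N', M') = tclass N' M' v"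
        using CT_common_word [OF t NM] .
      show ?thesis using mult u v NM tclass_mono by (simp del: mult_product_group)
    qed
  qed
qed

lemma group_CT: "group CT"
  using subgroup.subgroup_is_group [OF subgroup_CT group_full_product] complete_tensor_eq by simp

lemma CT_ext:
  assumes "s \<in> carrier CT" "t \<in> carrier CT" "\<And>N M. N \<in> P \<Longrightarrow> M \<in> P \<Longrightarrow> s (N, M) = t (N, M)"
  shows "s = t"
  using assms by (intro extensionalityI [of _ "P \<times> P"]) (auto simp: carrier_CT)

lemma inv_CT_apply:
  assumes "t \<in> carrier CT" "N \<in> P" "M \<in> P"
  shows "(inv\<^bsub>CT\<^esub> t) (N, M) = inv\<^bsub>quotient_tensor G N M\<^esub> t (N, M)"
proof -
  have "inv\<^bsub>CT\<^esub> t = inv\<^bsub>full_product\<^esub> t"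
    using group.m_inv_consistent [OF group_full_product subgroup_CT assms(1)] complete_tensor_eq
      by simp
  then show ?thesis
    using inv_full_product_apply [OF subsetD [OF subgroup.subset [OF subgroup_CT] assms(1)]
        assms(2,3)] by (simp only:)
qed

lemma one_CT: "\<one>\<^bsub>CT\<^esub> = thread []"
  by (subst complete_tensor_eq) (auto simp: thread_def one_quotient_tensor intro!: restrict_ext)

lemma thread_append:
  assumes "u \<in> twords G" "v \<in> twords G" shows "thread u \<otimes>\<^bsub>CT\<^esub> thread v = thread (u @ v)"
  using assms monoid.m_closed [OF group.is_monoid [OF group_CT]]
  by (intro CT_ext) (auto simp: mult_CT_apply mult_quotient_tensor)

lemma inv_thread:
  assumes "w \<in> twords G" shows "inv\<^bsub>CT\<^esub> thread w = thread (inv_word w)"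
  using assms group.inv_closed [OF group_CT]
  by (intro CT_ext) (auto simp: inv_CT_apply inv_quotient_tensor)

lemma generate_diagonal_symbols:
  "generate CT {tensor_symbol p G T x x |x. x \<in> carrier G} = thread ` diag_words" (is "?A = ?B")
proof
  show "?A \<subseteq> ?B"
  proof
    fix t assume "t \<in> ?A"
    then show "t \<in> ?B"
    proof (induction rule: generate.induct)
      case one
      then show ?case using one_CT by auto
    next
      case (incl t)
      then show ?case by (auto simp: tensor_symbol_eq_thread)
    next
      case (inv t)
      then obtain x where "x \<in> carrier G" "t = thread [(x, x, True)]"
        by (auto simp: tensor_symbol_eq_thread)
      then show ?case by (intro image_eqI [of _ _ "[(x, x, False)]"]) (auto simp: inv_thread)
    next
      case (eng s t)
      then obtain u v where "u \<in> diag_words" "v \<in> diag_words" "s = thread u" "t = thread v" by blast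
      then show ?case by (intro image_eqI [of _ _ "u @ v"]) (auto simp: thread_append
          diag_words_twords)
    qed
  qed
  have "thread w \<in> ?A" if "w \<in> diag_words" for w
    using that
  proof (induction w)
    case Nil
    show ?case using generate.one [of CT] by (simp add: one_CT)
  next
    case (Cons a w)
    then obtain x b where a: "a = (x, x, b)" and x: "x \<in> carrier G" and w: "w \<in> diag_words"
      by (cases a) auto
    have sym: "tensor_symbol p G T x x \<in> {tensor_symbol p G T x x |x. x \<in> carrier G}"
      using x by auto
    have "thread [(x, x, b)] \<in> ?A"
      using generate.incl [OF sym, of CT] generate.inv [OF sym, of CT] x
      by (cases b) (auto simp: tensor_symbol_eq_thread inv_thread)
    then have "thread [(x, x, b)] \<otimes>\<^bsub>CT\<^esub> thread w \<in> ?A"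
      using Cons.IH [OF w] by (rule generate.eng)
    then show ?case using x w a by (simp add: thread_append diag_words_twords)
  qed
  then show "?B \<subseteq> ?A" by blast
qed

abbreviation nabla where "nabla \<equiv> complete_nabla p G T"

text \<open>A basic open set restricts only finitely many components. The normal subgroups occurring in them
  have a common lower bound \<open>K\<close>, and a word that represents \<open>t\<close> at level \<open>(K, K)\<close> represents \<open>t\<close>
  in all of these components; so membership in the closure can be tested at the levels \<open>(N, N)\<close>.\<close>

lemma in_nabla_iff:
  "t \<in> nabla \<longleftrightarrow> t \<in> carrier CT \<and> (\<forall>N\<in>P. \<exists>w\<in>diag_words. t (N, N) = tclass N N w)"
proof -
  let ?X = "product_topology (\<lambda>(N, M). discrete_topology (carrier (quotient_tensor G N M))) (P \<times> P)"
  let ?Y = "complete_tensor_topology p G T"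
  have Y: "?Y = subtopology ?X (carrier CT)" by (simp add: complete_tensor_topology_def)
  have topX: "topspace ?X = carrier full_product" by (auto simp: split_def)
  have topY: "topspace ?Y = carrier CT"
    using subgroup.subset [OF subgroup_CT] unfolding Y topspace_subtopology topX by blast
  have nabla: "nabla = ?Y closure_of (thread ` diag_words)"
    unfolding complete_nabla_def generate_diagonal_symbols ..
  show ?thesis
  proof (intro iffI conjI ballI)
    assume t: "t \<in> nabla"
    then show tC: "t \<in> carrier CT" using topY unfolding nabla in_closure_of by blast
    fix N assume N: "N \<in> P"
    let ?U = "{s \<in> topspace ?X. s (N, N) \<in> {t (N, N)}}"
    have "openin ?X ?U"
      by (rule openin_continuous_map_preimage [OF continuous_map_product_projection [of "(N, N)"]])
         (use N tC subgroup.subset [OF subgroup_CT] in \<open>auto simp: PiE_iff\<close>)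
    then have "openin ?Y (carrier CT \<inter> ?U)" unfolding Y by (rule openin_subtopology_Int2)
    moreover have "t \<in> carrier CT \<inter> ?U"
      using tC subgroup.subset [OF subgroup_CT] unfolding topX by blast
    ultimately have "\<exists>y. y \<in> thread ` diag_words \<and> y \<in> carrier CT \<inter> ?U"
      using t [unfolded nabla in_closure_of, THEN conjunct2, THEN spec, of "carrier CT \<inter> ?U"]
        by (simp only: simp_thms)
    then obtain w where "w \<in> diag_words" "thread w (N, N) = t (N, N)" by blast
    then show "\<exists>w\<in>diag_words. t (N, N) = tclass N N w" using N by (metis thread_apply)
  next
    assume t: "t \<in> carrier CT \<and> (\<forall>N\<in>P. \<exists>w\<in>diag_words. t (N, N) = tclass N N w)"
    show "t \<in> nabla"
      unfolding nabla in_closure_of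
    proof (intro conjI allI impI)
      show "t \<in> topspace ?Y" using t topY by blast
      fix V assume V: "t \<in> V \<and> openin ?Y V"
      then obtain W where W: "openin ?X W" "V = W \<inter> carrier CT"
        unfolding Y openin_subtopology by (elim exE conjE) (rule that)
      then have "t \<in> W" using V by (simp only: Int_iff)
      from bspec [OF W(1) [unfolded openin_product_topology_alt] this]
      obtain U where fin: "finite {i \<in> P \<times> P. U i \<noteq> topspace (case i of (N, M) \<Rightarrow> discrete_topology
          (carrier (quotient_tensor G N M)))}" (is "finite ?F")
        and U: "t \<in> PiE (P \<times> P) U" "PiE (P \<times> P) U \<subseteq> W"
        by (elim exE conjE) (rule that)
      obtain K where K: "K \<in> P" "\<And>N. N \<in> fst ` ?F \<union> snd ` ?F \<Longrightarrow> K \<subseteq> N"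
        by (rule P_directed [of "fst ` ?F \<union> snd ` ?F"]) (use fin in auto)
      obtain w where w: "w \<in> diag_words" "t (K, K) = tclass K K w"
        using bspec [OF conjunct2 [OF t] K(1)] by (elim bexE) (rule that)
      have "thread w (N, M) \<in> U (N, M)" if NM: "N \<in> P" "M \<in> P" for N M
      proof (cases "(N, M) \<in> ?F")
        case True
        have "K \<subseteq> N" "K \<subseteq> M"
          using imageI [OF True, of fst] imageI [OF True, of snd]
          by (simp_all only: fst_conv snd_conv K(2) Un_iff simp_thms)
        then have "t (N, M) = tclass N M w"
          by (rule CT_coarser_level [OF conjunct1 [OF t] K(1) NM _ _ w(2) diag_words_twords [OF
              w(1)]])
        then show ?thesis using PiE_mem [OF U(1), of "(N, M)"] NM w(1) by simp
      next
        case False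
        then have "U (N, M) = carrier (quotient_tensor G N M)" using NM by simp
        then show ?thesis using NM diag_words_twords [OF w(1)]
          by (simp add: carrier_quotient_tensor)
      qed
      then have "thread w \<in> PiE (P \<times> P) U" by (auto simp: PiE_iff thread_def)
      then have "thread w \<in> V"
        using subsetD [OF U(2)] W(2) thread_in_CT [OF diag_words_twords [OF w(1)]]
          by (simp only: Int_iff)
      then show "\<exists>y. y \<in> thread ` diag_words \<and> y \<in> V" using imageI [OF w(1), of thread]
        by (intro exI conjI)
    qed
  qed
qed

lemma nabla_carrier: "t \<in> nabla \<Longrightarrow> t \<in> carrier CT"
  by (simp add: in_nabla_iff)

lemma nabla_word:
  assumes "t \<in> nabla" "N \<in> P" obtains w where "w \<in> diag_words" "t (N, N) = tclass N N w"
  using assms by (auto simp: in_nabla_iff)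

lemma thread_in_nabla: "w \<in> diag_words \<Longrightarrow> thread w \<in> nabla"
  by (auto simp: in_nabla_iff diag_words_twords)

lemmas CT_m_closed = monoid.m_closed [OF group.is_monoid [OF group_CT]]

lemma subgroup_nabla: "subgroup nabla CT"
proof (rule group.subgroupI [OF group_CT])
  show "nabla \<subseteq> carrier CT" by (rule subsetI) (rule nabla_carrier)
  show "nabla \<noteq> {}" using thread_in_nabla [of "[]"] by auto
  fix s assume s: "s \<in> nabla"
  note sC = nabla_carrier [OF s]
  show "inv\<^bsub>CT\<^esub> s \<in> nabla"
    unfolding in_nabla_iff
  proof (intro conjI ballI)
    show "inv\<^bsub>CT\<^esub> s \<in> carrier CT" by (rule group.inv_closed [OF group_CT sC])
    fix N assume N: "N \<in> P"
    obtain w where w: "w \<in> diag_words" "s (N, N) = tclass N N w" using nabla_word [OF s N] .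
    show "\<exists>w\<in>diag_words. (inv\<^bsub>CT\<^esub> s) (N, N) = tclass N N w"
      using w sC N diag_words_twords [OF w(1)]
      by (intro bexI [of _ "inv_word w"]) (simp_all add: inv_CT_apply inv_quotient_tensor)
  qed
  fix t assume t: "t \<in> nabla"
  show "s \<otimes>\<^bsub>CT\<^esub> t \<in> nabla"
    unfolding in_nabla_iff
  proof (intro conjI ballI)
    show "s \<otimes>\<^bsub>CT\<^esub> t \<in> carrier CT" by (rule CT_m_closed [OF sC nabla_carrier [OF t]])
    fix N assume N: "N \<in> P"
    obtain u where u: "u \<in> diag_words" "s (N, N) = tclass N N u" using nabla_word [OF s N] .
    obtain v where v: "v \<in> diag_words" "t (N, N) = tclass N N v" using nabla_word [OF t N] .
    show "\<exists>w\<in>diag_words. (s \<otimes>\<^bsub>CT\<^esub> t) (N, N) = tclass N N w"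
      using N u v diag_words_twords [OF u(1)] diag_words_twords [OF v(1)]
      by (intro bexI [of _ "u @ v"]) (simp_all add: mult_CT_apply mult_quotient_tensor)
  qed
qed

lemma one_complete_exterior: "\<one>\<^bsub>complete_exterior p G T\<^esub> = nabla"
  by (simp add: complete_exterior_def)

lemma exterior_symbol_eq_one_iff:
  assumes "x \<in> carrier G" "y \<in> carrier G"
  shows "exterior_symbol p G T x y = \<one>\<^bsub>complete_exterior p G T\<^esub> \<longleftrightarrow> (\<forall>N\<in>P. normal.wedge_trivial N G
      x y)"
proof -
  have C: "tensor_symbol p G T x y \<in> carrier CT" using assms by (simp add: tensor_symbol_eq_thread)
  have "normal.wedge_trivial N G x y \<longleftrightarrow> (\<exists>w\<in>diag_words. tclass N N [(x, y, True)] = tclass N N w)"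
    if "N \<in> P" for N
  proof -
    interpret normal N G using P_normal that .
    show ?thesis using assms by (simp add: wedge_trivial_def econg_def tclass_eq_iff)
  qed
  then have "tensor_symbol p G T x y \<in> nabla \<longleftrightarrow> (\<forall>N\<in>P. normal.wedge_trivial N G x y)"
    using C unfolding in_nabla_iff tensor_symbol_eq_thread by simp
  moreover have "exterior_symbol p G T x y = nabla \<longleftrightarrow> tensor_symbol p G T x y \<in> nabla"
    unfolding exterior_symbol_def
    by (rule iffI [OF group.coset_join1 [OF group_CT _ C subgroup_nabla]
          group.coset_join2 [OF group_CT C subgroup_nabla]])
  ultimately show ?thesis by (simp add: one_complete_exterior)
qed

lemma exterior_symbol_eq_imp_econg:
  assumes "x \<in> carrier G" "y \<in> carrier G" "x' \<in> carrier G" "y' \<in> carrier G"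
    and "exterior_symbol p G T x y = exterior_symbol p G T x' y'" and N: "N \<in> P"
  shows "normal.econg N G [(x, y, True)] [(x', y', True)]"
proof -
  interpret normal N G using P_normal N .
  have "thread [(x, y, True)] \<in> nabla #>\<^bsub>CT\<^esub> thread [(x', y', True)]"
    using assms group.rcos_self [OF group_CT _ subgroup_nabla, of "thread [(x, y, True)]"]
    by (simp add: exterior_symbol_def tensor_symbol_eq_thread)
  then obtain s where s: "s \<in> nabla" "thread [(x, y, True)] = s \<otimes>\<^bsub>CT\<^esub> thread [(x', y', True)]"
    by (auto simp: r_coset_def)
  obtain w where w: "w \<in> diag_words" "s (N, N) = tclass N N w" using nabla_word [OF s(1) N] .
  have "tclass N N [(x, y, True)] = (s \<otimes>\<^bsub>CT\<^esub> thread [(x', y', True)]) (N, N)"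
    using N s(2) by (metis thread_apply)
  also have "\<dots> = tclass N N (w @ [(x', y', True)])"
    using N w assms by (simp add: mult_CT_apply mult_quotient_tensor diag_words_twords)
  finally show ?thesis
    using w assms unfolding econg_def by (subst (asm) tclass_eq_iff) auto
qed

text \<open>At level \<open>N\<close> every element of the coset of \<open>x \<otimes> y\<close> modulo \<open>\<nabla>\<close> is represented by words whose
  commutator lies in the coset of \<open>[x, y] = 1\<close>, because the diagonal symbols contribute
  \<open>[g, g] = 1\<close>; and \<open>1\<close> is the only element lying in all \<open>N\<close>.\<close>

lemma exterior_symbol_in_schur_multiplier:
  assumes x: "x \<in> carrier G" and y: "y \<in> carrier G" and comm: "commutator G x y = \<one>"
  shows "exterior_symbol p G T x y \<in> schur_multiplier p G T"
proof -
  let ?X = "exterior_symbol p G T x y"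
  have X: "?X = nabla #>\<^bsub>CT\<^esub> thread [(x, y, True)]"
    by (simp add: exterior_symbol_def tensor_symbol_eq_thread)
  have carr: "?X \<in> carrier (complete_exterior p G T)"
    unfolding complete_exterior_def X using x y
    by (auto simp: carrier_FactGroup)
  have eval: "tensor_commutator p G T t = \<one>" if t: "t \<in> ?X" for t
  proof -
    obtain s where s: "s \<in> nabla" "t = s \<otimes>\<^bsub>CT\<^esub> thread [(x, y, True)]"
      using t unfolding X r_coset_def by blast
    have mem: "tword_commutator G u \<in> N" if N: "N \<in> P" and u: "u \<in> t (N, N)" for N u
    proof -
      interpret normal N G using P_normal N .
      obtain w where w: "w \<in> diag_words" "s (N, N) = tclass N N w" using nabla_word [OF s(1) N] .
      have "t (N, N) = tclass N N (w @ [(x, y, True)])"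
        using N w x y s by (simp add: mult_CT_apply mult_quotient_tensor diag_words_twords)
      then have c: "tcong G N N u (w @ [(x, y, True)])" using u by (simp add: tclass_def)
      then have "N #> tword_commutator G u = N #> \<one>"
        using tcong_tword_commutator [OF c] w x y comm
        by (simp add: diag_words_twords tword_commutator_diag_words)
      moreover have "u \<in> twords G" using tcong_twords [OF c] by simp
      ultimately show ?thesis using r_coset_eq_iff_mem [of "tword_commutator G u"]
        by (simp add: subset)
    qed
    have ne: "t (N, N) \<noteq> {} \<and> (\<forall>u\<in>t (N, N). u \<in> twords G)" if "N \<in> P" for N
    proof -
      have "t \<in> carrier CT"
        using s x y CT_m_closed [OF nabla_carrier [OF s(1)], of "thread [(x, y, True)]"] by simp
      then obtain w where "w \<in> twords G" "t (N, N) = tclass N N w" using \<open>N \<in> P\<close>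
        unfolding carrier_CT by blast
      then show ?thesis using tclass_self [of w N N] tcong_twords unfolding tclass_def by blast
    qed
    show ?thesis
      unfolding tensor_commutator_def
    proof (rule the_equality)
      show "\<one> \<in> carrier G \<and> (\<forall>N\<in>P. \<forall>w\<in>t (N, N). tword_commutator G w \<in> N #> \<one>)"
        using mem P_subgroup by (auto simp: coset_mult_one subgroup.subset)
      fix g assume g: "g \<in> carrier G \<and> (\<forall>N\<in>P. \<forall>w\<in>t (N, N). tword_commutator G w \<in> N #> g)"
      have "g \<in> N" if N: "N \<in> P" for N
      proof -
        interpret normal N G using P_normal N .
        obtain u where u: "u \<in> t (N, N)" using ne N by blast
        then have "N #> g = N #> tword_commutator G u"
          using g N by (intro repr_independence subgroup_axioms) auto
        also have "\<dots> = N" using mem [OF N u] u ne [OF N] by (simp add: r_coset_eq_iff_mem)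
        finally show ?thesis using g r_coset_eq_iff_mem by blast
      qed
      then show "g = \<one>" using g Inter_P by blast
    qed
  qed
  have "thread [(x, y, True)] \<in> ?X"
    unfolding X using x y by (intro group.rcos_self group_CT subgroup_nabla) simp
  then have "tensor_commutator p G T ` ?X = {\<one>}" using eval by force
  then have "exterior_commutator p G T ?X = \<one>" by (simp add: exterior_commutator_def)
  then show ?thesis using carr by (simp add: schur_multiplier_def kernel_def)
qed

end

section \<open>Directed limits of Radon measures\<close>

lemma radon_space: assumes "radon_probability X m" shows "space m = topspace X"
proof -
  have sets: "sets m = sigma_sets (topspace X) {U. openin X U}"
    using assms by (simp add: radon_probability_def)
  have "topspace X \<in> sets m" unfolding sets by (rule sigma_sets.Basic) simp
  moreover have "space m \<subseteq> topspace X"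
    using sigma_sets_into_sp [of "{U. openin X U}" "topspace X" "space m"] sets.top [of m]
    unfolding sets by (auto dest: openin_subset)
  ultimately show ?thesis using sets.sets_into_space by blast
qed

lemma radon_finite_measure: assumes "radon_probability X m" shows "finite_measure m"
proof (rule finite_measureI)
  have "emeasure m (topspace X) = 1" using assms by (simp add: radon_probability_def)
  then show "emeasure m (space m) \<noteq> \<infinity>" by (simp add: radon_space [OF assms])
qed

lemma radon_measure_space: assumes "radon_probability X m" shows "measure m (topspace X) = 1"
  using assms by (simp add: radon_probability_def measure_def)

lemma radon_open: assumes "radon_probability X m" "openin X U" shows "U \<in> sets m"
  using assms by (auto simp: radon_probability_def intro: sigma_sets.Basic)

lemma radon_closed: assumes "radon_probability X m" "closedin X C" shows "C \<in> sets m"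
proof -
  have "openin X (topspace X - C)" using assms(2) by (simp add: closedin_def)
  then have "space m - (topspace X - C) \<in> sets m"
    by (intro sets.compl_sets radon_open [OF assms(1)])
  then show ?thesis
    unfolding radon_space [OF assms(1)] double_diff [OF closedin_subset [OF assms(2)] order_refl] .
qed

lemma radon_outer_regular:
  assumes m: "radon_probability X m" and A: "A \<in> sets m" and e: "e > (0::real)"
  obtains U where "openin X U" "A \<subseteq> U" "measure m U < measure m A + e"
proof -
  interpret finite_measure m by (rule radon_finite_measure [OF m])
  have "(INF U\<in>{U. openin X U \<and> A \<subseteq> U}. emeasure m U) = emeasure m A"
    using m A by (simp add: radon_probability_def)
  also have "\<dots> < emeasure m A + ennreal e"
    using e by (simp add: emeasure_eq_measure ennreal_less_iff flip: ennreal_plus)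
  finally obtain U where U: "openin X U" "A \<subseteq> U" "emeasure m U < emeasure m A + ennreal e"
    unfolding INF_less_iff by blast
  then have "measure m U < measure m A + e"
    using e by (simp add: emeasure_eq_measure ennreal_less_iff flip: ennreal_plus)
  then show thesis using that U(1,2) by simp
qed

context pro_p
begin

text \<open>The finite intersection property, for a family of closed sets that is directed because \<open>P\<close> is.\<close>

lemma P_compactness:
  assumes X: "compact_space X" and C: "\<And>N. N \<in> P \<Longrightarrow> closedin X (C N)"
    and mono: "\<And>N M. N \<in> P \<Longrightarrow> M \<in> P \<Longrightarrow> N \<subseteq> M \<Longrightarrow> C N \<subseteq> C M"
    and U: "openin X U" "(\<Inter>N\<in>P. C N) \<subseteq> U"
  obtains N where "N \<in> P" "C N \<subseteq> U"
proof -
  have "\<exists>N\<in>P. C N - U = {}"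
  proof (rule ccontr)
    assume none: "\<not> (\<exists>N\<in>P. C N - U = {})"
    have fip: "\<Inter>\<F> \<noteq> {}" if F: "finite \<F>" "\<F> \<subseteq> (\<lambda>N. C N - U) ` P" for \<F>
    proof -
      obtain \<G> where G: "finite \<G>" "\<G> \<subseteq> P" "\<F> = (\<lambda>N. C N - U) ` \<G>"
        using finite_subset_image [OF F] by blast
      obtain K where K: "K \<in> P" "\<And>N. N \<in> \<G> \<Longrightarrow> K \<subseteq> N" using P_directed [OF G(1,2)] by blast
      have "C K - U \<subseteq> \<Inter>\<F>"
      proof (unfold G(3), rule INF_greatest)
        fix N assume "N \<in> \<G>"
        then show "C K - U \<subseteq> C N - U" using mono [OF K(1) _ K(2)] G(2) by blast
      qed
      then show ?thesis using none K(1) by blast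
    qed
    have clo: "closedin X D" if "D \<in> (\<lambda>N. C N - U) ` P" for D
      using that C U(1) by (auto intro: closedin_diff)
    have "\<Inter>((\<lambda>N. C N - U) ` P) \<noteq> {}"
      using X [unfolded compact_space_fip, THEN spec, of "(\<lambda>N. C N - U) ` P"] clo fip by blast
    then show False using U(2) carrier_in_P by blast
  qed
  then show thesis using that by blast
qed

text \<open>An open set of almost the same measure contains the intersection by outer regularity, and then a
  member of the family by compactness. This replaces monotone convergence, as \<open>P\<close> may be
  uncountable.\<close>

lemma radon_limit:
  assumes X: "compact_space X" and m: "radon_probability X m" and C: "\<And>N. N \<in> P \<Longrightarrow> closedin X (C N)"
    and mono: "\<And>N M. N \<in> P \<Longrightarrow> M \<in> P \<Longrightarrow> N \<subseteq> M \<Longrightarrow> C N \<subseteq> C M"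
    and e: "e > (0::real)"
  obtains N where "N \<in> P" "measure m (C N) < measure m (\<Inter>N\<in>P. C N) + e"
proof -
  interpret finite_measure m by (rule radon_finite_measure [OF m])
  have "closedin X (\<Inter>N\<in>P. C N)"
    using C carrier_in_P by (intro closedin_INT) auto
  then obtain U where U: "openin X U" "(\<Inter>N\<in>P. C N) \<subseteq> U" "measure m U < measure m (\<Inter>N\<in>P. C N) + e"
    using radon_outer_regular [OF m radon_closed [OF m] e] by metis
  obtain N where N: "N \<in> P" "C N \<subseteq> U" using P_compactness [OF X C mono U(1,2)] .
  have "measure m (C N) \<le> measure m U"
    by (rule finite_measure_mono [OF N(2) radon_open [OF m U(1)]])
  then show thesis using that N(1) U(3) by simp
qed

end

section \<open>Haar measure of unions of cosets\<close>

context pro_p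
begin

text \<open>Unions of cosets of \<open>N\<close> and of products of two cosets of \<open>N\<close>, that is, the preimages of subsets of
  \<open>G / N\<close> and of \<open>G / N \<times> G / N\<close>.\<close>

definition saturated :: "'a set \<Rightarrow> 'a set \<Rightarrow> bool" where
  "saturated N A \<longleftrightarrow> A \<subseteq> carrier G \<and>
     (\<forall>x\<in>carrier G. \<forall>x'\<in>carrier G. N #> x = N #> x' \<longrightarrow> x \<in> A \<longrightarrow> x' \<in> A)"

definition pair_saturated :: "'a set \<Rightarrow> ('a \<times> 'a) set \<Rightarrow> bool" where
  "pair_saturated N S \<longleftrightarrow> S \<subseteq> carrier G \<times> carrier G \<and>
     (\<forall>x\<in>carrier G. \<forall>x'\<in>carrier G. \<forall>y\<in>carrier G. \<forall>y'\<in>carrier G.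
        N #> x = N #> x' \<longrightarrow> N #> y = N #> y' \<longrightarrow> (x, y) \<in> S \<longrightarrow> (x', y') \<in> S)"

lemma saturatedD:
  "saturated N A \<Longrightarrow> x \<in> A \<Longrightarrow> x' \<in> carrier G \<Longrightarrow> N #> x = N #> x' \<Longrightarrow> x' \<in> A"
  unfolding saturated_def by blast

lemma pair_saturatedD:
  "pair_saturated N S \<Longrightarrow> (x, y) \<in> S \<Longrightarrow> x' \<in> carrier G \<Longrightarrow> y' \<in> carrier G \<Longrightarrow>
    N #> x = N #> x' \<Longrightarrow> N #> y = N #> y' \<Longrightarrow> (x', y') \<in> S"
  unfolding pair_saturated_def by blast

lemma saturated_carrier: "saturated N A \<Longrightarrow> A \<subseteq> carrier G"
  by (simp add: saturated_def)

lemma pair_saturated_carrier: "pair_saturated N S \<Longrightarrow> S \<subseteq> carrier G \<times> carrier G"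
  by (simp add: pair_saturated_def)

lemma r_cosetD:
  assumes "N \<in> P" "x \<in> carrier G" "x' \<in> N #> x"
  shows "x' \<in> carrier G" "N #> x = N #> x'"
  using subgroup.elemrcos_carrier [OF P_subgroup [OF assms(1)] is_group assms(2,3)]
    repr_independence [OF assms(3,2) P_subgroup [OF assms(1)]] by simp_all

lemma r_coset_self: "N \<in> P \<Longrightarrow> x \<in> carrier G \<Longrightarrow> x \<in> N #> x"
  by (intro rcos_self P_subgroup)

lemma openin_saturated: assumes "N \<in> P" "saturated N A" shows "openin T A"
proof (subst openin_subopen, intro ballI)
  fix x assume x: "x \<in> A"
  then have xG: "x \<in> carrier G" using saturated_carrier [OF assms(2)] by (rule rev_subsetD)
  have "N #> x \<subseteq> A"
    by (rule subsetI) (rule saturatedD [OF assms(2) x r_cosetD [OF assms(1) xG]])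
  then show "\<exists>U. openin T U \<and> x \<in> U \<and> U \<subseteq> A"
    by (intro exI [of _ "N #> x"] conjI openin_r_coset r_coset_self assms(1) xG)
qed

lemma closedin_saturated: assumes "N \<in> P" "saturated N A" shows "closedin T A"
proof -
  have "saturated N (carrier G - A)"
    unfolding saturated_def
  proof (intro conjI ballI impI)
    fix x x' assume G: "x \<in> carrier G" "x' \<in> carrier G" "N #> x = N #> x'" "x \<in> carrier G - A"
    then show "x' \<in> carrier G - A" using saturatedD [OF assms(2) _ G(1) G(3) [symmetric]] by blast
  qed simp
  from openin_saturated [OF assms(1) this] show ?thesis
    using saturated_carrier [OF assms(2)] by (simp add: closedin_def)
qed

lemma openin_pair_saturated: assumes "N \<in> P" "pair_saturated N S"
  shows "openin (prod_topology T T) S"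
proof (subst openin_subopen, intro ballI)
  fix xy assume xy: "xy \<in> S"
  then have "xy \<in> carrier G \<times> carrier G" using pair_saturated_carrier [OF assms(2)]
    by (rule rev_subsetD)
  then obtain x y where e: "xy = (x, y)" and G: "x \<in> carrier G" "y \<in> carrier G" by (rule SigmaE)
  have "(N #> x) \<times> (N #> y) \<subseteq> S"
  proof clarify
    fix x' y' assume *: "x' \<in> N #> x" "y' \<in> N #> y"
    show "(x', y') \<in> S"
      using r_cosetD [OF assms(1) G(1) *(1)] r_cosetD [OF assms(1) G(2) *(2)]
      by (simp add: pair_saturatedD [OF assms(2) xy [unfolded e]])
  qed
  moreover have "openin (prod_topology T T) ((N #> x) \<times> (N #> y))"
    unfolding openin_prod_Times_iff by (intro disjI2 conjI openin_r_coset assms(1) G)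
  moreover have "xy \<in> (N #> x) \<times> (N #> y)"
    unfolding e by (intro SigmaI r_coset_self assms(1) G)
  ultimately show "\<exists>U. openin (prod_topology T T) U \<and> xy \<in> U \<and> U \<subseteq> S" by (intro exI conjI)
qed

lemma closedin_pair_saturated: assumes "N \<in> P" "pair_saturated N S"
  shows "closedin (prod_topology T T) S"
proof -
  have "pair_saturated N (carrier G \<times> carrier G - S)"
    unfolding pair_saturated_def
  proof (intro conjI ballI impI)
    fix x x' y y' assume G: "x \<in> carrier G" "x' \<in> carrier G" "y \<in> carrier G" "y' \<in> carrier G"
      and e: "N #> x = N #> x'" "N #> y = N #> y'" and "(x, y) \<in> carrier G \<times> carrier G - S"
    then show "(x', y') \<in> carrier G \<times> carrier G - S"
      using pair_saturatedD [OF assms(2) _ G(1,3) e [symmetric]] by blast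
  qed simp
  from openin_pair_saturated [OF assms(1) this] show ?thesis
    using pair_saturated_carrier [OF assms(2)] by (simp add: closedin_def)
qed

lemma r_coset_mono:
  assumes "N \<in> P" "M \<in> P" "N \<subseteq> M" "x \<in> carrier G" "x' \<in> carrier G" "N #> x = N #> x'"
  shows "M #> x = M #> x'"
proof -
  have "x \<in> N #> x'" using r_coset_self [OF assms(1,4)] assms(6) by simp
  then have "x \<in> M #> x'" using assms(3) unfolding r_coset_def by blast
  then show ?thesis by (rule r_cosetD(2) [OF assms(2,5), symmetric])
qed

lemma pair_saturated_mono:
  assumes "pair_saturated M S" "N \<in> P" "M \<in> P" "N \<subseteq> M" shows "pair_saturated N S"
  unfolding pair_saturated_def
proof (intro conjI ballI impI)
  show "S \<subseteq> carrier G \<times> carrier G" by (rule pair_saturated_carrier [OF assms(1)])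
  fix x x' y y' assume G: "x \<in> carrier G" "x' \<in> carrier G" "y \<in> carrier G" "y' \<in> carrier G"
    and e: "N #> x = N #> x'" "N #> y = N #> y'" and S: "(x, y) \<in> S"
  show "(x', y') \<in> S"
    using pair_saturatedD [OF assms(1) S G(2,4) r_coset_mono [OF assms(2-4) G(1,2) e(1)]
        r_coset_mono [OF assms(2-4) G(3,4) e(2)]] .
qed

end

locale pro_p_haar = pro_p G p T for G :: "('a, 'm) monoid_scheme" (structure) and p T +
  fixes \<mu> :: "'a measure" and \<nu> :: "('a \<times> 'a) measure"
  assumes haar: "normalized_haar_measure G T \<mu>" and radon_prod: "radon_product T \<mu> \<nu>"
begin

lemma radon_\<mu>: "radon_probability T \<mu>"
  using haar by (simp add: normalized_haar_measure_def)

lemma radon_\<nu>: "radon_probability (prod_topology T T) \<nu>"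
  using radon_prod by (simp add: radon_product_def)

sublocale m: finite_measure \<mu> by (rule radon_finite_measure [OF radon_\<mu>])

sublocale n: finite_measure \<nu> by (rule radon_finite_measure [OF radon_\<nu>])

lemma space_\<mu> [simp]: "space \<mu> = carrier G"
  using radon_space [OF radon_\<mu>] by simp

lemma space_\<nu> [simp]: "space \<nu> = carrier G \<times> carrier G"
  using radon_space [OF radon_\<nu>] by simp

lemma measure_carrier [simp]: "measure \<mu> (carrier G) = 1"
  using radon_measure_space [OF radon_\<mu>] by simp

lemma measure_le_one: "measure \<mu> A \<le> 1"
  using m.bounded_measure [of A] by simp

lemma compact_TT: "compact_space (prod_topology T T)"
  by (simp add: compact_space_prod_topology compact_T)

text \<open>The Radon product prescribes the measure of rectangles; that rectangles are Borel sets of the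
  product space follows from the continuity of the projections.\<close>

lemma fst_measurable: "fst \<in> measurable \<nu> \<mu>" and snd_measurable: "snd \<in> measurable \<nu> \<mu>"
proof -
  have sets: "sets \<mu> = sigma_sets (carrier G) {U. openin T U}"
    using radon_\<mu> by (simp add: radon_probability_def)
  have pow: "{U. openin T U} \<subseteq> Pow (carrier G)" using openin_subset [of T] by auto
  have "f -` U \<inter> space \<nu> \<in> sets \<nu>" if "continuous_map (prod_topology T T) T f" "U \<in> {U. openin T
      U}" for f U
  proof -
    have "f -` U \<inter> space \<nu> = {x \<in> topspace (prod_topology T T). f x \<in> U}" by auto
    then show ?thesis
      using radon_open [OF radon_\<nu> openin_continuous_map_preimage [OF that(1)]] that(2) by simp
  qed
  note pre = this
  show "fst \<in> measurable \<nu> \<mu>"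
    by (rule measurable_sigma_sets [OF sets pow]) (use pre [OF continuous_map_fst] in auto)
  show "snd \<in> measurable \<nu> \<mu>"
    by (rule measurable_sigma_sets [OF sets pow]) (use pre [OF continuous_map_snd] in auto)
qed

lemma Times_sets: assumes "A \<in> sets \<mu>" "B \<in> sets \<mu>" shows "A \<times> B \<in> sets \<nu>"
proof -
  have "A \<times> B = (fst -` A \<inter> space \<nu>) \<inter> (snd -` B \<inter> space \<nu>)"
    using sets.sets_into_space [OF assms(1)] sets.sets_into_space [OF assms(2)] by auto
  then show ?thesis
    using measurable_sets [OF fst_measurable assms(1)] measurable_sets [OF snd_measurable
        assms(2)] by simp
qed

lemma measure_Times:
  assumes "A \<in> sets \<mu>" "B \<in> sets \<mu>" shows "measure \<nu> (A \<times> B) = measure \<mu> A * measure \<mu> B"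
  using radon_prod assms by (simp add: radon_product_def measure_def enn2real_mult)

lemma rcosetsE:
  assumes "c \<in> rcosets N" obtains g where "g \<in> carrier G" "c = N #> g"
  using assms by (auto simp: RCOSETS_def)

lemma coset_in_sets: "N \<in> P \<Longrightarrow> c \<in> rcosets N \<Longrightarrow> c \<in> sets \<mu>"
  using radon_open [OF radon_\<mu> openin_r_coset] by (auto simp: RCOSETS_def)

lemma carrier_in_sets: "carrier G \<in> sets \<mu>"
  using sets.top [of \<mu>] by simp

lemma disjoint_rcosets: "N \<in> P \<Longrightarrow> disjoint_family_on (\<lambda>c. c) (rcosets N)"
  using rcos_disjoint [OF P_subgroup] by (auto simp: disjoint_family_on_def pairwise_def disjnt_def)

lemma sum_measure_Int_rcosets:
  assumes N: "N \<in> P" and Y: "Y \<in> sets \<mu>"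
  shows "(\<Sum>c\<in>rcosets N. measure \<mu> (Y \<inter> c)) = measure \<mu> Y"
proof -
  have "disjoint_family_on (\<lambda>c. Y \<inter> c) (rcosets N)"
    using disjoint_rcosets [OF N] unfolding disjoint_family_on_def by blast
  then have "measure \<mu> (\<Union>c\<in>rcosets N. Y \<inter> c) = (\<Sum>c\<in>rcosets N. measure \<mu> (Y \<inter> c))"
    using Y coset_in_sets [OF N] P_rcosets_finite [OF N]
    by (intro m.finite_measure_finite_Union) auto
  moreover have "(\<Union>c\<in>rcosets N. Y \<inter> c) = Y \<inter> \<Union>(rcosets N)" by blast
  moreover have "Y \<inter> \<Union>(rcosets N) = Y"
    using rcosets_part_G [OF P_subgroup [OF N]] sets.sets_into_space [OF Y] by auto
  ultimately show ?thesis by simp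
qed

text \<open>Right cosets of a normal subgroup are left cosets, so left invariance gives all of them the same
  measure.\<close>

lemma measure_coset:
  assumes N: "N \<in> P" and c: "c \<in> rcosets N" shows "measure \<mu> c = 1 / card (rcosets N)"
proof -
  interpret normal N G by (rule P_normal [OF N])
  have eq: "measure \<mu> d = measure \<mu> N" if "d \<in> rcosets N" for d
  proof -
    obtain g where "g \<in> carrier G" "d = N #> g" using \<open>d \<in> rcosets N\<close> by (rule rcosetsE)
    then have g: "g \<in> carrier G" "d = g <# N" using coset_eq by simp_all
    have "N \<in> sets \<mu>" by (rule coset_in_sets [OF N subgroup_in_rcosets [OF is_group]])
    then show ?thesis using haar g by (simp add: normalized_haar_measure_def measure_def)
  qed
  have int: "carrier G \<inter> d = d" if "d \<in> rcosets N" for d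
    using rcosets_carrier [OF is_group that] by blast
  have "(\<Sum>d\<in>rcosets N. measure \<mu> (carrier G \<inter> d)) = 1"
    using sum_measure_Int_rcosets [OF N carrier_in_sets] by simp
  moreover have "(\<Sum>d\<in>rcosets N. measure \<mu> (carrier G \<inter> d)) = (\<Sum>d\<in>rcosets N. measure \<mu> N)"
    using eq int by (intro sum.cong) simp_all
  ultimately have one: "real (card (rcosets N)) * measure \<mu> N = 1" by simp
  then have "real (card (rcosets N)) \<noteq> 0" by (metis mult_zero_left zero_neq_one)
  then show ?thesis using one eq [OF c] by (simp only: eq_divide_eq mult.commute) simp
qed

lemma measure_saturated:
  assumes N: "N \<in> P" and A: "saturated N A"
  shows "measure \<mu> A = card ((\<lambda>x. N #> x) ` A) / card (rcosets N)"
proof -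
  let ?I = "(\<lambda>x. N #> x) ` A"
  have AG: "A \<subseteq> carrier G" using A by (simp add: saturated_def)
  have sub: "?I \<subseteq> rcosets N" using AG by (auto simp: RCOSETS_def)
  have fin: "finite ?I" using finite_subset [OF sub P_rcosets_finite [OF N]] .
  have "A = \<Union>?I"
  proof (intro equalityI subsetI)
    fix x assume "x \<in> A"
    then show "x \<in> \<Union>?I" using rcos_self [OF _ P_subgroup [OF N], of x] AG by blast
  next
    fix x assume "x \<in> \<Union>?I"
    then obtain y where y: "y \<in> A" "x \<in> N #> y" by blast
    then show "x \<in> A" using r_cosetD [OF N subsetD [OF AG y(1)] y(2)]
      by (simp add: saturatedD [OF A y(1)])
  qed
  then have "measure \<mu> A = measure \<mu> (\<Union>c\<in>?I. c)" by simp
  also have "\<dots> = (\<Sum>c\<in>?I. measure \<mu> c)"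
    using fin sub coset_in_sets [OF N] disjoint_family_on_mono [OF sub disjoint_rcosets [OF N]]
    by (intro m.finite_measure_finite_Union) auto
  also have "\<dots> = (\<Sum>c\<in>?I. 1 / card (rcosets N))"
    using measure_coset [OF N] sub by (intro sum.cong) auto
  finally show ?thesis by simp
qed

text \<open>Fubini for a union of products of cosets: the slices are constant along each coset of \<open>N\<close>, so the
  integral over the first coordinate is a finite sum. Here \<open>S `` c\<close> is the common slice over the
  points of \<open>c\<close>.\<close>

lemma measure_slices:
  assumes N: "N \<in> P" and S: "pair_saturated N S" and Y: "Y \<in> sets \<mu>"
  shows "measure \<nu> (S \<inter> (Y \<times> carrier G)) = (\<Sum>c\<in>rcosets N. measure \<mu> (Y \<inter> c) * measure \<mu> (S `` c))"
proof -
  have SG: "S \<subseteq> carrier G \<times> carrier G" using S by (simp add: pair_saturated_def)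
  have slice: "(x, y) \<in> S" if "c \<in> rcosets N" "x \<in> c" "y \<in> S `` c" for c x y
  proof -
    obtain g where g: "g \<in> carrier G" "c = N #> g" using \<open>c \<in> rcosets N\<close> by (rule rcosetsE)
    obtain x' where x': "x' \<in> c" "(x', y) \<in> S" using \<open>y \<in> S `` c\<close> by blast
    have "N #> x' = N #> x" "x \<in> carrier G" "x' \<in> carrier G"
      using r_cosetD [OF N g(1)] that(2) x'(1) unfolding g(2) by metis+
    moreover have "y \<in> carrier G" using x'(2) SG by blast
    ultimately show ?thesis using pair_saturatedD [OF S x'(2), of x y] by simp
  qed
  have slice_saturated: "saturated N (S `` c)" if "c \<in> rcosets N" for c
    unfolding saturated_def
  proof (intro conjI ballI impI)
    show "S `` c \<subseteq> carrier G" using SG by blast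
    fix y y' assume y: "y \<in> carrier G" "y' \<in> carrier G" "N #> y = N #> y'" "y \<in> S `` c"
    then obtain x where x: "x \<in> c" "(x, y) \<in> S" by blast
    then have "(x, y') \<in> S" using pair_saturatedD [OF S x(2) _ y(2) HOL.refl y(3)] SG by blast
    then show "y' \<in> S `` c" using x(1) by blast
  qed
  have meas: "S `` c \<in> sets \<mu>" if "c \<in> rcosets N" for c
    using radon_open [OF radon_\<mu> openin_saturated [OF N slice_saturated [OF that]]] .
  have "S \<inter> (Y \<times> carrier G) = (\<Union>c\<in>rcosets N. (Y \<inter> c) \<times> (S `` c))"
  proof (intro equalityI subsetI)
    fix xy assume xy: "xy \<in> S \<inter> (Y \<times> carrier G)"
    then obtain x y where e: "xy = (x, y)" "(x, y) \<in> S" "x \<in> Y" "x \<in> carrier G" using SG by blast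
    have "x \<in> N #> x" by (rule rcos_self [OF e(4) P_subgroup [OF N]])
    moreover have "N #> x \<in> rcosets N" using e(4) by (auto simp: RCOSETS_def)
    ultimately show "xy \<in> (\<Union>c\<in>rcosets N. (Y \<inter> c) \<times> (S `` c))" using e by blast
  next
    fix xy assume "xy \<in> (\<Union>c\<in>rcosets N. (Y \<inter> c) \<times> (S `` c))"
    then obtain c x y where "c \<in> rcosets N" "xy = (x, y)" "x \<in> Y" "x \<in> c" "y \<in> S `` c" by blast
    moreover from this have "(x, y) \<in> S" by (intro slice)
    ultimately show "xy \<in> S \<inter> (Y \<times> carrier G)" using SG by blast
  qed
  moreover have "measure \<nu> (\<Union>c\<in>rcosets N. (Y \<inter> c) \<times> (S `` c)) = (\<Sum>c\<in>rcosets N. measure \<nu> ((Y \<inter> c)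
      \<times> (S `` c)))"
  proof (rule n.finite_measure_finite_Union [OF P_rcosets_finite [OF N]])
    show "(\<lambda>c. (Y \<inter> c) \<times> (S `` c)) ` (rcosets N) \<subseteq> sets \<nu>"
      using Times_sets [OF sets.Int [OF Y coset_in_sets [OF N]] meas] by blast
    show "disjoint_family_on (\<lambda>c. (Y \<inter> c) \<times> (S `` c)) (rcosets N)"
      using disjoint_rcosets [OF N] unfolding disjoint_family_on_def by blast
  qed
  moreover have "(\<Sum>c\<in>rcosets N. measure \<nu> ((Y \<inter> c) \<times> (S `` c))) = (\<Sum>c\<in>rcosets N. measure \<mu> (Y \<inter> c)
      * measure \<mu> (S `` c))"
    using measure_Times [OF sets.Int [OF Y coset_in_sets [OF N]] meas] by (intro sum.cong) auto
  ultimately show ?thesis by simp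
qed

text \<open>The index of \<open>H\<close> is a power of \<open>p\<close> other than \<open>1\<close>, hence at least \<open>p\<close>.\<close>

lemma measure_proper_subgroup:
  assumes N: "N \<in> P" and H: "subgroup H G" "saturated N H" "H \<noteq> carrier G"
  shows "measure \<mu> H \<le> 1 / real p"
proof -
  interpret N: normal N G by (rule P_normal [OF N])
  interpret q: group_hom G "G Mod N" "\<lambda>a. N #> a" by (rule N.r_coset_group_hom)
  let ?K = "(\<lambda>x. N #> x) ` H"
  have carr: "carrier (G Mod N) = rcosets N" by (simp add: FactGroup_def)
  obtain k where k: "card (rcosets N) = p ^ k"
    using N by (auto simp: p_quotients_def order_def carr)
  have K: "subgroup ?K (G Mod N)" by (rule q.subgroup_img_is_subgroup [OF H(1)])
  then have "card ?K dvd p ^ k"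
    using group.lagrange [OF N.factorgroup_is_group K] unfolding order_def carr k
      by (metis dvd_triv_right)
  then obtain i where i: "i \<le> k" "card ?K = p ^ i" unfolding divides_primepow_nat [OF prime_p]
    by blast
  have "i \<noteq> k"
  proof
    assume "i = k"
    then have "?K = rcosets N"
      using card_subset_eq [OF P_rcosets_finite [OF N], of ?K] subgroup.subset [OF K] i(2) k carr
        by simp
    then have "x \<in> H" if x: "x \<in> carrier G" for x
    proof -
      have "N #> x \<in> ?K" using \<open>?K = rcosets N\<close> x by (auto simp: RCOSETS_def)
      then obtain h where "h \<in> H" "N #> x = N #> h" by blast
      then show ?thesis using H(2) x by (metis saturatedD)
    qed
    then show False using H(3) subgroup.subset [OF H(1)] by blast
  qed
  then have "p * p ^ i \<le> p ^ k"
    using i(1) prime_gt_0_nat [OF prime_p]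
      by (metis power_Suc power_increasing Suc_leI le_neq_implies_less One_nat_def)
  then have "real p * real (card ?K) \<le> real (card (rcosets N))" using i(2) k
    by (metis of_nat_le_iff of_nat_mult)
  moreover have "real (card (rcosets N)) > 0" "real p > 0" using k prime_gt_0_nat [OF prime_p]
    by simp_all
  ultimately show ?thesis unfolding measure_saturated [OF N H(2)] by (simp add: field_simps)
qed

end

section \<open>Pairs with trivial wedge and commuting pairs\<close>

context pro_p_haar
begin

definition wedge_level :: "'a set \<Rightarrow> ('a \<times> 'a) set" where
  "wedge_level N = {(x, y). normal.wedge_trivial N G x y}"

definition commuting_level :: "'a set \<Rightarrow> ('a \<times> 'a) set" where
  "commuting_level N = {(x, y). x \<in> carrier G \<and> y \<in> carrier G \<and> commutator G x y \<in> N}"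

definition wedge_pairs :: "('a \<times> 'a) set" where
  "wedge_pairs = {(x, y). x \<in> carrier G \<and> y \<in> carrier G \<and>
     exterior_symbol p G T x y = \<one>\<^bsub>complete_exterior p G T\<^esub>}"

definition commuting_pairs :: "('a \<times> 'a) set" where
  "commuting_pairs = {(x, y). x \<in> carrier G \<and> y \<in> carrier G \<and> commutator G x y = \<one>}"

lemma pair_saturated_wedge_level: assumes "N \<in> P" shows "pair_saturated N (wedge_level N)"
proof -
  interpret normal N G by (rule P_normal [OF assms])
  show ?thesis
    unfolding pair_saturated_def
  proof (intro conjI ballI impI)
    show "wedge_level N \<subseteq> carrier G \<times> carrier G"
      using wedge_trivial_carrier by (auto simp: wedge_level_def)
    fix x x' y y' assume "x \<in> carrier G" "x' \<in> carrier G" "y \<in> carrier G" "y' \<in> carrier G"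
      and "N #> x = N #> x'" "N #> y = N #> y'" and "(x, y) \<in> wedge_level N"
    then show "(x', y') \<in> wedge_level N"
      using wedge_trivial_coset [of x x' y y'] by (simp add: wedge_level_def)
  qed
qed

lemma pair_saturated_commuting_level: assumes "N \<in> P" shows "pair_saturated N (commuting_level N)"
proof -
  interpret normal N G by (rule P_normal [OF assms])
  show ?thesis
    unfolding pair_saturated_def
  proof (intro conjI ballI impI)
    show "commuting_level N \<subseteq> carrier G \<times> carrier G" by (auto simp: commuting_level_def)
    fix x x' y y' assume "x \<in> carrier G" "x' \<in> carrier G" "y \<in> carrier G" "y' \<in> carrier G"
      and "N #> x = N #> x'" "N #> y = N #> y'" and "(x, y) \<in> commuting_level N"
    then show "(x', y') \<in> commuting_level N"
      using commutator_mem_coset [of x x' y y'] by (simp add: commuting_level_def)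
  qed
qed

lemma wedge_level_mono:
  assumes "N \<in> P" "M \<in> P" "N \<subseteq> M" shows "wedge_level N \<subseteq> wedge_level M"
  using normal.wedge_trivial_mono [OF P_normal [OF assms(1)] _ P_normal [OF assms(2)] assms(3)]
  by (auto simp: wedge_level_def)

lemma commuting_level_mono: "N \<subseteq> M \<Longrightarrow> commuting_level N \<subseteq> commuting_level M"
  by (auto simp: commuting_level_def)

lemma wedge_level_sym: assumes "N \<in> P" shows "(x, y) \<in> wedge_level N \<longleftrightarrow> (y, x) \<in> wedge_level N"
  using normal.wedge_trivial_sym [OF P_normal [OF assms]] by (simp add: wedge_level_def)

lemma commuting_level_sym:
  assumes "N \<in> P" shows "(x, y) \<in> commuting_level N \<longleftrightarrow> (y, x) \<in> commuting_level N"
  using normal.commutator_mem_sym [OF P_normal [OF assms], of x y]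
    by (auto simp: commuting_level_def)

lemma wedge_pairs_eq: "wedge_pairs = (\<Inter>N\<in>P. wedge_level N)"
proof (intro equalityI subsetI)
  fix xy assume "xy \<in> wedge_pairs"
  then show "xy \<in> (\<Inter>N\<in>P. wedge_level N)"
    using exterior_symbol_eq_one_iff by (auto simp: wedge_pairs_def wedge_level_def)
next
  fix xy assume xy: "xy \<in> (\<Inter>N\<in>P. wedge_level N)"
  obtain x y where e: "xy = (x, y)" by (cases xy)
  have "(x, y) \<in> carrier G \<times> carrier G"
    using xy carrier_in_P pair_saturated_carrier [OF pair_saturated_wedge_level] unfolding e
      by blast
  then show "xy \<in> wedge_pairs"
    using xy exterior_symbol_eq_one_iff [of x y] by (simp add: e wedge_pairs_def wedge_level_def)
qed

lemma commuting_pairs_eq: "commuting_pairs = (\<Inter>N\<in>P. commuting_level N)"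
proof (intro equalityI subsetI)
  fix xy assume "xy \<in> commuting_pairs"
  then show "xy \<in> (\<Inter>N\<in>P. commuting_level N)"
    using subgroup.one_closed [OF P_subgroup]
      by (auto simp: commuting_pairs_def commuting_level_def)
next
  fix xy assume xy: "xy \<in> (\<Inter>N\<in>P. commuting_level N)"
  obtain x y where e: "xy = (x, y)" by (cases xy)
  have G: "x \<in> carrier G" "y \<in> carrier G" and c: "\<And>N. N \<in> P \<Longrightarrow> commutator G x y \<in> N"
    using xy carrier_in_P unfolding e by (auto simp: commuting_level_def)
  then have "commutator G x y = \<one>" by (intro Inter_P commutator_closed)
  then show "xy \<in> commuting_pairs" using G by (simp add: e commuting_pairs_def)
qed

lemma wedge_level_subset_commuting_level:
  assumes "N \<in> P" shows "wedge_level N \<subseteq> commuting_level N"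
  using normal.wedge_trivial_imp_commutator_mem [OF P_normal [OF assms]]
    normal.wedge_trivial_carrier [OF P_normal [OF assms]]
  by (auto simp: wedge_level_def commuting_level_def)

lemma wedge_pairs_subset: "wedge_pairs \<subseteq> commuting_pairs"
  unfolding wedge_pairs_eq commuting_pairs_eq using wedge_level_subset_commuting_level by blast

lemma closedin_wedge_level: "N \<in> P \<Longrightarrow> closedin (prod_topology T T) (wedge_level N)"
  by (rule closedin_pair_saturated [OF _ pair_saturated_wedge_level])

lemma closedin_commuting_level: "N \<in> P \<Longrightarrow> closedin (prod_topology T T) (commuting_level N)"
  by (rule closedin_pair_saturated [OF _ pair_saturated_commuting_level])

lemma wedge_pairs_sets: "wedge_pairs \<in> sets \<nu>"
  unfolding wedge_pairs_eq
  by (intro radon_closed [OF radon_\<nu>] closedin_INT closedin_wedge_level) (use carrier_in_P in auto)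

lemma commuting_pairs_sets: "commuting_pairs \<in> sets \<nu>"
  unfolding commuting_pairs_eq
  by (intro radon_closed [OF radon_\<nu>] closedin_INT closedin_commuting_level)
    (use carrier_in_P in auto)

definition center_level :: "'a set \<Rightarrow> 'a set" where
  "center_level N = {x \<in> carrier G. \<forall>y\<in>carrier G. (x, y) \<in> commuting_level N}"

definition exterior_center_level :: "'a set \<Rightarrow> 'a set" where
  "exterior_center_level N = {x \<in> carrier G. \<forall>y\<in>carrier G. (x, y) \<in> wedge_level N}"

lemma saturated_full_slices:
  assumes "pair_saturated N S" shows "saturated N {x \<in> carrier G. \<forall>y\<in>carrier G. (x, y) \<in> S}"
  unfolding saturated_def
proof (intro conjI ballI impI)
  fix x x' assume "x \<in> carrier G" "x' \<in> carrier G" "N #> x = N #> x'"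
    and "x \<in> {x \<in> carrier G. \<forall>y\<in>carrier G. (x, y) \<in> S}"
  then show "x' \<in> {x \<in> carrier G. \<forall>y\<in>carrier G. (x, y) \<in> S}"
    using pair_saturatedD [OF assms, of x _ x'] by blast
qed blast

lemma exterior_center_eq: "exterior_center p G T = (\<Inter>N\<in>P. exterior_center_level N)"
proof -
  have "exterior_center p G T = {x \<in> carrier G. \<forall>y\<in>carrier G. (x, y) \<in> wedge_pairs}"
    by (auto simp: exterior_center_def wedge_pairs_def)
  also have "\<dots> = (\<Inter>N\<in>P. exterior_center_level N)"
    unfolding wedge_pairs_eq exterior_center_level_def using carrier_in_P by blast
  finally show ?thesis .
qed

lemma group_center_eq: "group_center G = {x \<in> carrier G. \<forall>y\<in>carrier G. (x, y) \<in> commuting_pairs}"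
  by (auto simp: group_center_def commuting_pairs_def commutator_eq_one_iff)

lemma closedin_exterior_center_level: "N \<in> P \<Longrightarrow> closedin T (exterior_center_level N)"
  unfolding exterior_center_level_def
    by (rule closedin_saturated [OF _ saturated_full_slices [OF pair_saturated_wedge_level]])

lemma exterior_center_sets: "exterior_center p G T \<in> sets \<mu>"
  unfolding exterior_center_eq
  by (intro radon_closed [OF radon_\<mu>] closedin_INT closedin_exterior_center_level)
    (use carrier_in_P in auto)

lemma group_center_sets: "group_center G \<in> sets \<mu>"
proof -
  have "group_center G = (\<Inter>N\<in>P. center_level N)"
    unfolding group_center_eq commuting_pairs_eq center_level_def using carrier_in_P by blast
  moreover have "closedin T (center_level N)" if "N \<in> P" for N
    unfolding center_level_def
      by (rule closedin_saturated [OF that saturated_full_slices [OF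
          pair_saturated_commuting_level [OF that]]])
  ultimately show ?thesis using carrier_in_P
    by (simp only:) (intro radon_closed [OF radon_\<mu>] closedin_INT, auto)
qed

lemma saturated_slice:
  assumes "pair_saturated N S" "x \<in> carrier G" shows "saturated N {y. (x, y) \<in> S}"
  unfolding saturated_def
proof (intro conjI ballI impI)
  show "{y. (x, y) \<in> S} \<subseteq> carrier G" using pair_saturated_carrier [OF assms(1)] by blast
  fix y y' assume "y \<in> carrier G" "y' \<in> carrier G" "N #> y = N #> y'" "y \<in> {y. (x, y) \<in> S}"
  then show "y' \<in> {y. (x, y) \<in> S}" using pair_saturatedD [OF assms(1) _ assms(2), of x y y'] by simp
qed

lemma Image_r_coset:
  assumes "N \<in> P" "pair_saturated N S" "x \<in> carrier G" shows "S `` (N #> x) = {y. (x, y) \<in> S}"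
proof (intro equalityI subsetI)
  fix y assume "y \<in> S `` (N #> x)"
  then obtain x' where x': "x' \<in> N #> x" "(x', y) \<in> S" by blast
  moreover have "y \<in> carrier G" using x'(2) pair_saturated_carrier [OF assms(2)] by blast
  ultimately show "y \<in> {y. (x, y) \<in> S}"
    using pair_saturatedD [OF assms(2) x'(2) assms(3) _ r_cosetD(2) [OF assms(1,3) x'(1),
        symmetric]] by simp
next
  fix y assume "y \<in> {y. (x, y) \<in> S}"
  then show "y \<in> S `` (N #> x)" using r_coset_self [OF assms(1,3)] by blast
qed

section \<open>The upper bound\<close>

text \<open>The slices over the exterior center of level \<open>N\<close> are everything; each other slice is a proper
  subgroup and has measure at most \<open>1 / p\<close>.\<close>

lemma measure_wedge_over_center_le:
  assumes N: "N \<in> P" and Y: "Y \<in> sets \<mu>"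
  shows "measure \<nu> (wedge_level N \<inter> (Y \<times> carrier G))
           \<le> measure \<mu> Y / p + (1 - 1 / p) * measure \<mu> (exterior_center_level N)"
proof -
  interpret N: normal N G by (rule P_normal [OF N])
  let ?E = "exterior_center_level N"
  have p: "real p \<ge> 1" using prime_gt_0_nat [OF prime_p] by simp
  have E: "?E \<in> sets \<mu>" by (rule radon_closed [OF radon_\<mu> closedin_exterior_center_level [OF N]])
  have "measure \<nu> (wedge_level N \<inter> (Y \<times> carrier G))
      = (\<Sum>c\<in>rcosets N. measure \<mu> (Y \<inter> c) * measure \<mu> (wedge_level N `` c))"
    by (rule measure_slices [OF N pair_saturated_wedge_level [OF N] Y])
  also have "\<dots> \<le> (\<Sum>c\<in>rcosets N. measure \<mu> (Y \<inter> c) / p + (1 - 1 / p) * measure \<mu> (?E \<inter> c))"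
  proof (rule sum_mono)
    fix c assume c: "c \<in> rcosets N"
    then obtain x where x: "x \<in> carrier G" "c = N #> x" by (rule rcosetsE)
    let ?H = "{y. (x, y) \<in> wedge_level N}"
    have slice: "wedge_level N `` c = ?H"
      unfolding x(2) by (rule Image_r_coset [OF N pair_saturated_wedge_level [OF N] x(1)])
    show "measure \<mu> (Y \<inter> c) * measure \<mu> (wedge_level N `` c)
        \<le> measure \<mu> (Y \<inter> c) / p + (1 - 1 / p) * measure \<mu> (?E \<inter> c)"
    proof (cases "x \<in> ?E")
      case True
      have "c \<subseteq> ?E"
      proof
        fix x' assume "x' \<in> c"
        then have "x' \<in> carrier G" "N #> x = N #> x'" using r_cosetD [OF N x(1)] x(2) by auto
        then show "x' \<in> ?E"
          using saturatedD [OF saturated_full_slices [OF pair_saturated_wedge_level [OF N]]] True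
          unfolding exterior_center_level_def by blast
      qed
      then have "measure \<mu> (Y \<inter> c) \<le> measure \<mu> (?E \<inter> c)"
        using E coset_in_sets [OF N c] by (intro m.finite_measure_mono) auto
      then have "(1 - 1 / p) * measure \<mu> (Y \<inter> c) \<le> (1 - 1 / p) * measure \<mu> (?E \<inter> c)"
        using p by (intro mult_left_mono) auto
      moreover have "measure \<mu> (Y \<inter> c) * measure \<mu> (wedge_level N `` c) \<le> measure \<mu> (Y \<inter> c) * 1"
        by (intro mult_left_mono measure_le_one) simp
      ultimately show ?thesis by (simp add: algebra_simps)
    next
      case False
      have "?H = {y. normal.wedge_trivial N G y x}"
        using N.wedge_trivial_sym by (auto simp: wedge_level_def)
      then have "subgroup ?H G" using N.subgroup_wedge_trivial [OF x(1)] by simp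
      moreover have "?H \<noteq> carrier G" using False x(1) by (auto simp: exterior_center_level_def)
      ultimately have "measure \<mu> ?H \<le> 1 / p"
        using saturated_slice [OF pair_saturated_wedge_level [OF N] x(1)]
          by (intro measure_proper_subgroup [OF N])
      then have "measure \<mu> (Y \<inter> c) * measure \<mu> ?H \<le> measure \<mu> (Y \<inter> c) * (1 / p)"
        by (intro mult_left_mono) simp_all
      moreover have "0 \<le> (1 - 1 / p) * measure \<mu> (?E \<inter> c)" using p by simp
      ultimately show ?thesis unfolding slice by simp
    qed
  qed
  also have "\<dots> = (\<Sum>c\<in>rcosets N. measure \<mu> (Y \<inter> c)) / p + (1 - 1 / p) * (\<Sum>c\<in>rcosets N. measure \<mu>
      (?E \<inter> c))"
    by (simp add: sum.distrib sum_divide_distrib sum_distrib_left)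
  finally show ?thesis unfolding sum_measure_Int_rcosets [OF N Y] sum_measure_Int_rcosets [OF N E] .
qed

text \<open>Outside \<open>Z(G) \<times> G\<close> it suffices that a trivial wedge implies a trivial commutator. The subset
  \<open>Z(G) \<times> G\<close> consists of commuting pairs only, and there the previous estimate is passed to the
  limit over \<open>N\<close>.\<close>

lemma exterior_degree_upper_bound:
  "measure \<nu> wedge_pairs \<le> measure \<nu> commuting_pairs
     - ((real p - 1) / real p) * (measure \<mu> (group_center G) - measure \<mu> (exterior_center p G T))"
proof -
  let ?Z = "group_center G" and ?E = "exterior_center p G T"
  have p: "real p \<ge> 1" using prime_gt_0_nat [OF prime_p] by simp
  have ZG: "?Z \<times> carrier G \<in> sets \<nu>" by (rule Times_sets [OF group_center_sets carrier_in_sets])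
  have part: "measure \<nu> (wedge_pairs \<inter> (?Z \<times> carrier G)) \<le> measure \<mu> ?Z / p + (1 - 1 / p) *
      measure \<mu> ?E"
  proof (rule field_le_epsilon)
    fix e :: real assume e: "e > 0"
    obtain N where N: "N \<in> P" "measure \<mu> (exterior_center_level N) < measure \<mu> (\<Inter>N\<in>P.
        exterior_center_level N) + e"
    proof (rule radon_limit [OF compact_T radon_\<mu> closedin_exterior_center_level _ e])
      fix N M assume "N \<in> P" "M \<in> P" "N \<subseteq> M"
      then show "exterior_center_level N \<subseteq> exterior_center_level M"
        using wedge_level_mono unfolding exterior_center_level_def by blast
    qed
    have "measure \<nu> (wedge_pairs \<inter> (?Z \<times> carrier G)) \<le> measure \<nu> (wedge_level N \<inter> (?Z \<times> carrier G))"
      using N(1) ZG radon_closed [OF radon_\<nu> closedin_wedge_level [OF N(1)]]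
      by (intro n.finite_measure_mono) (auto simp: wedge_pairs_eq)
    also have "\<dots> \<le> measure \<mu> ?Z / p + (1 - 1 / p) * measure \<mu> (exterior_center_level N)"
      by (rule measure_wedge_over_center_le [OF N(1) group_center_sets])
    also have "\<dots> \<le> measure \<mu> ?Z / p + (1 - 1 / p) * (measure \<mu> ?E + e)"
      using N(2) p unfolding exterior_center_eq by (intro add_left_mono mult_left_mono) auto
    also have "\<dots> \<le> measure \<mu> ?Z / p + (1 - 1 / p) * measure \<mu> ?E + e"
      using e p by (simp add: algebra_simps)
    finally show "measure \<nu> (wedge_pairs \<inter> (?Z \<times> carrier G)) \<le> measure \<mu> ?Z / p + (1 - 1 / p) *
        measure \<mu> ?E + e" .
  qed
  have "measure \<nu> wedge_pairs
      = measure \<nu> (wedge_pairs \<inter> (?Z \<times> carrier G)) + measure \<nu> (wedge_pairs - ?Z \<times> carrier G)"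
    using n.finite_measure_Diff' [OF wedge_pairs_sets ZG] by simp
  moreover have "measure \<nu> (wedge_pairs - ?Z \<times> carrier G) \<le> measure \<nu> (commuting_pairs - ?Z \<times>
      carrier G)"
    using wedge_pairs_subset commuting_pairs_sets ZG by (intro n.finite_measure_mono) auto
  moreover have "commuting_pairs \<inter> (?Z \<times> carrier G) = ?Z \<times> carrier G"
    unfolding group_center_eq by auto
  then have "measure \<nu> (commuting_pairs - ?Z \<times> carrier G) = measure \<nu> commuting_pairs - measure \<mu>
      ?Z"
    using n.finite_measure_Diff' [OF commuting_pairs_sets ZG]
      measure_Times [OF group_center_sets carrier_in_sets] by simp
  ultimately have "measure \<nu> wedge_pairs
      \<le> measure \<mu> ?Z / p + (1 - 1 / p) * measure \<mu> ?E + measure \<nu> commuting_pairs - measure \<mu> ?Z"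
    using part by linarith
  also have "\<dots> = measure \<nu> commuting_pairs - ((real p - 1) / real p) * (measure \<mu> ?Z - measure \<mu>
      ?E)"
    using p by (simp add: field_simps)
  finally show ?thesis .
qed

section \<open>The lower bound\<close>

text \<open>The value of the wedge of a pair in the exterior square of \<open>G / N\<close>, as a class of words.\<close>

definition level_value :: "'a set \<Rightarrow> 'a \<times> 'a \<Rightarrow> 'a tword set" where
  "level_value N xy = {w. normal.econg N G w [(fst xy, snd xy, True)]}"

lemma level_value_eq_iff:
  assumes "N \<in> P" "x \<in> carrier G" "y \<in> carrier G"
  shows "level_value N (x, y) = level_value N (x', y') \<longleftrightarrow> normal.econg N G [(x, y, True)] [(x', y',
      True)]"
proof -
  interpret normal N G by (rule P_normal [OF assms(1)])
  have "econg [(x, y, True)] [(x, y, True)]" using assms(2,3) by (intro econg_refl) simp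
  then show ?thesis
    unfolding level_value_def by (auto intro: econg_trans econg_sym)
qed

text \<open>The value at level \<open>N\<close> is determined by the value in the complete exterior square, which for a
  commuting pair lies in the Schur multiplier.\<close>

lemma level_values_bound:
  assumes "N \<in> P" "finite (schur_multiplier p G T)"
  shows "finite (level_value N ` commuting_pairs)"
    "card (level_value N ` commuting_pairs) \<le> card (schur_multiplier p G T)"
proof -
  define s where "s xy = exterior_symbol p G T (fst xy) (snd xy)" for xy
  \<comment> \<open>Recovers the value at level \<open>N\<close> from the value in the complete exterior square.\<close>
  define r where "r a = level_value N (SOME xy. xy \<in> commuting_pairs \<and> s xy = a)" for a
  have r: "level_value N xy = r (s xy)" if xy: "xy \<in> commuting_pairs" for xy
  proof -
    define uv where "uv = (SOME uv. uv \<in> commuting_pairs \<and> s uv = s xy)"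
    have "uv \<in> commuting_pairs \<and> s uv = s xy"
      unfolding uv_def by (rule someI [of _ xy]) (simp add: xy)
    then have uv: "uv \<in> commuting_pairs" "s xy = s uv" by simp_all
    obtain x y u v where e: "xy = (x, y)" "uv = (u, v)" by (cases xy, cases uv)
    have G: "x \<in> carrier G" "y \<in> carrier G" "u \<in> carrier G" "v \<in> carrier G"
      using xy uv(1) by (auto simp: e commuting_pairs_def)
    have "normal.econg N G [(x, y, True)] [(u, v, True)]"
      using uv(2) by (intro exterior_symbol_eq_imp_econg [OF G _ assms(1)]) (simp add: s_def e)
    then have "level_value N xy = level_value N uv"
      unfolding e level_value_eq_iff [OF assms(1) G(1,2)] .
    then show ?thesis by (simp add: r_def uv_def)
  qed
  have sub: "s ` commuting_pairs \<subseteq> schur_multiplier p G T"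
    using exterior_symbol_in_schur_multiplier by (auto simp: s_def commuting_pairs_def)
  have fin: "finite (s ` commuting_pairs)" by (rule finite_subset [OF sub assms(2)])
  have eq: "level_value N ` commuting_pairs = r ` s ` commuting_pairs"
    using r by (simp add: image_image)
  show "finite (level_value N ` commuting_pairs)" unfolding eq using fin by (rule finite_imageI)
  have "card (level_value N ` commuting_pairs) \<le> card (s ` commuting_pairs)"
    unfolding eq by (rule card_image_le [OF fin])
  also have "\<dots> \<le> card (schur_multiplier p G T)" by (rule card_mono [OF assms(2) sub])
  finally show "card (level_value N ` commuting_pairs) \<le> card (schur_multiplier p G T)" .
qed

text \<open>Each of the finitely many nontrivial values of commuting pairs is nontrivial at some level. At a
  level below all of these, every nontrivial value is detected.\<close>

lemma wedge_pairs_at_finite_level: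
  assumes fin: "finite (schur_multiplier p G T)"
  obtains N where "N \<in> P" "commuting_pairs \<inter> wedge_level N \<subseteq> wedge_pairs"
proof -
  define s where "s xy = exterior_symbol p G T (fst xy) (snd xy)" for xy
  let ?B = "commuting_pairs - wedge_pairs"
  have "s ` ?B \<subseteq> schur_multiplier p G T"
    using exterior_symbol_in_schur_multiplier by (auto simp: s_def commuting_pairs_def)
  then have finB: "finite (s ` ?B)" using fin by (rule finite_subset)
  have "\<exists>N\<in>P. \<forall>xy\<in>?B. s xy = a \<longrightarrow> xy \<notin> wedge_level N" if a: "a \<in> s ` ?B" for a
  proof -
    obtain uv where uv: "uv \<in> ?B" "a = s uv" using a by blast
    obtain N where N: "N \<in> P" "uv \<notin> wedge_level N" using uv(1) unfolding wedge_pairs_eq by blast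
    interpret normal N G by (rule P_normal [OF N(1)])
    have "xy \<notin> wedge_level N" if xy: "xy \<in> ?B" "s xy = a" for xy
    proof
      assume w: "xy \<in> wedge_level N"
      obtain x y u v where e: "xy = (x, y)" "uv = (u, v)" by (cases xy, cases uv)
      have G: "x \<in> carrier G" "y \<in> carrier G" "u \<in> carrier G" "v \<in> carrier G"
        using xy uv(1) by (auto simp: e commuting_pairs_def)
      have "econg [(u, v, True)] [(x, y, True)]"
        using xy(2) uv(2) by (intro exterior_symbol_eq_imp_econg [OF G(3,4,1,2) _ N(1)]) (simp
            add: s_def e)
      moreover have "econg [(x, y, True)] []"
        using w by (simp add: e wedge_level_def wedge_trivial_def)
      ultimately have "econg [(u, v, True)] []" by (rule econg_trans)
      then show False using N(2) by (simp add: e wedge_level_def wedge_trivial_def)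
    qed
    then show ?thesis using N(1) by blast
  qed
  then obtain f where f: "\<And>a. a \<in> s ` ?B \<Longrightarrow> f a \<in> P"
    "\<And>a xy. a \<in> s ` ?B \<Longrightarrow> xy \<in> ?B \<Longrightarrow> s xy = a \<Longrightarrow> xy \<notin> wedge_level (f a)"
    by metis
  obtain K where K: "K \<in> P" "\<And>N. N \<in> f ` s ` ?B \<Longrightarrow> K \<subseteq> N"
    by (rule P_directed [of "f ` s ` ?B"]) (use finB f(1) in auto)
  have "xy \<in> wedge_pairs" if xy: "xy \<in> commuting_pairs" "xy \<in> wedge_level K" for xy
  proof (rule ccontr)
    assume "xy \<notin> wedge_pairs"
    with xy(1) have B: "xy \<in> ?B" by simp
    then have sB: "s xy \<in> s ` ?B" by (rule imageI)
    have "wedge_level K \<subseteq> wedge_level (f (s xy))"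
      by (rule wedge_level_mono [OF K(1) f(1) [OF sB] K(2) [OF imageI [OF sB]]])
    then show False using f(2) [OF sB B HOL.refl] xy(2) by blast
  qed
  then show thesis using that K(1) by blast
qed

text \<open>The pairs whose value at level \<open>M\<close> is attained by a commuting pair form an open set containing the
  commuting pairs. By compactness it contains the pairs that commute modulo \<open>N\<close> for some \<open>N\<close>.\<close>

lemma commuting_values_at_finite_level:
  assumes M: "M \<in> P"
  obtains N where "N \<in> P" "level_value M ` commuting_level N \<subseteq> level_value M ` commuting_pairs"
proof -
  interpret normal M G by (rule P_normal [OF M])
  let ?U = "{xy \<in> carrier G \<times> carrier G. level_value M xy \<in> level_value M ` commuting_pairs}"
  have "pair_saturated M ?U"
    unfolding pair_saturated_def
  proof (intro conjI ballI impI)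
    fix x x' y y' assume G: "x \<in> carrier G" "x' \<in> carrier G" "y \<in> carrier G" "y' \<in> carrier G"
      and c: "M #> x = M #> x'" "M #> y = M #> y'" and U: "(x, y) \<in> ?U"
    have "level_value M (x, y) = level_value M (x', y')"
      unfolding level_value_eq_iff [OF M G(1,3)] by (rule econg_symbol_coset [OF G c])
    then show "(x', y') \<in> ?U" using U G by simp
  qed blast
  then have U: "openin (prod_topology T T) ?U" by (rule openin_pair_saturated [OF M])
  have sub: "(\<Inter>N\<in>P. commuting_level N) \<subseteq> ?U"
    unfolding commuting_pairs_eq [symmetric] by (auto simp: commuting_pairs_def)
  obtain N where N: "N \<in> P" "commuting_level N \<subseteq> ?U"
  proof (rule P_compactness [OF compact_TT closedin_commuting_level _ U sub])
    show "commuting_level N \<subseteq> commuting_level N'" if "N \<subseteq> N'" for N N'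
      by (rule commuting_level_mono [OF that])
  qed
  have "level_value M ` commuting_level N \<subseteq> level_value M ` commuting_pairs"
    using N(2) by (intro image_subsetI) blast
  then show thesis by (rule that [OF N(1)])
qed

text \<open>In \<open>G / N\<close> the elements \<open>x\<close> of the centralizer of \<open>z\<close> with a given value of \<open>x \<and> z\<close> at level \<open>M\<close>
  lie in a single right coset of the subgroup of those with trivial value. Hence the index of that
  subgroup is at most the number of values.\<close>

lemma measure_centralizer_le:
  assumes M: "M \<in> P" and N: "N \<in> P" and NM: "N \<subseteq> M" and z: "z \<in> carrier G"
    and V: "finite V" "level_value M ` commuting_level N \<subseteq> V"
  shows "measure \<mu> {x. (z, x) \<in> commuting_level N}
           \<le> card V * measure \<mu> {x. (z, x) \<in> commuting_level N \<inter> wedge_level M}"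
proof -
  interpret M: normal M G by (rule P_normal [OF M])
  interpret N: normal N G by (rule P_normal [OF N])
  let ?C = "{x. (z, x) \<in> commuting_level N}" and ?R = "{x. (z, x) \<in> commuting_level N \<inter>
      wedge_level M}"
  let ?q = "\<lambda>x. N #> x"
  have CG: "?C \<subseteq> carrier G" by (auto simp: commuting_level_def)
  have C_comm: "commutator G x z \<in> N \<and> x \<in> carrier G" if "x \<in> ?C" for x
    using that commuting_level_sym [OF N, of z x] by (simp add: commuting_level_def)
  define v where "v x = level_value M (x, z)" for x
  have vV: "v ` ?C \<subseteq> V"
    using V(2) commuting_level_sym [OF N, of z] unfolding v_def by blast
  have satC: "saturated N ?C" by (rule saturated_slice [OF pair_saturated_commuting_level [OF N] z])
  have "pair_saturated N (commuting_level N \<inter> wedge_level M)"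
    using pair_saturated_commuting_level [OF N] pair_saturated_mono [OF pair_saturated_wedge_level
        [OF M] N M NM]
    unfolding pair_saturated_def by blast
  then have satR: "saturated N ?R" by (rule saturated_slice [OF _ z])
  have finR: "finite (?q ` ?R)"
    by (rule finite_subset [OF _ P_rcosets_finite [OF N]]) (use CG in \<open>auto simp: RCOSETS_def\<close>)
  \<comment> \<open>A representative of each value: the elements with that value lie in its right coset of \<open>?R\<close>.\<close>
  define w where "w a = (SOME x. x \<in> ?C \<and> v x = a)" for a
  have w: "w a \<in> ?C \<and> v (w a) = a" if a: "a \<in> v ` ?C" for a
  proof -
    obtain x where "x \<in> ?C \<and> v x = a" using a by blast
    then show ?thesis unfolding w_def by (rule someI)
  qed
  have cover: "?q ` ?C \<subseteq> (\<Union>a\<in>v ` ?C. (\<lambda>c. c \<otimes>\<^bsub>G Mod N\<^esub> ?q (w a)) ` ?q ` ?R)"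
  proof
    fix c assume "c \<in> ?q ` ?C"
    then obtain x where x: "x \<in> ?C" "c = ?q x" by blast
    define y where "y = w (v x)"
    have y: "y \<in> ?C" "v y = v x" using w [OF imageI [OF x(1)]] by (simp_all add: y_def)
    note xc = C_comm [OF x(1)] and yc = C_comm [OF y(1)]
    define t where "t = x \<otimes> inv y"
    have t: "t \<in> carrier G" and x_eq: "x = t \<otimes> y" using xc yc by (simp_all add: t_def m_assoc)
    have "M.econg [(t \<otimes> y, z, True)] [(y, z, True)]"
      using y(2) level_value_eq_iff [OF M, of x z y z] xc z unfolding x_eq v_def by simp
    then have "M.wedge_trivial t z" using M.econg_mult_left_iff [of t y z] t yc z by simp
    moreover have "commutator G t z \<in> N"
      unfolding t_def using N.commutator_mem_mult_inv [of x y z] xc yc z by simp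
    ultimately have "t \<in> ?R"
      using commuting_level_sym [OF N, of z t] wedge_level_sym [OF M, of z t] t z
      by (simp add: commuting_level_def wedge_level_def)
    moreover have "c = ?q t \<otimes>\<^bsub>G Mod N\<^esub> ?q y"
      unfolding x(2) x_eq using t yc by (simp add: N.rcos_sum)
    ultimately show "c \<in> (\<Union>a\<in>v ` ?C. (\<lambda>c. c \<otimes>\<^bsub>G Mod N\<^esub> ?q (w a)) ` ?q ` ?R)"
      using x(1) unfolding y_def by blast
  qed
  have finv: "finite (v ` ?C)" by (rule finite_subset [OF vV V(1)])
  have "card (?q ` ?C) \<le> card (\<Union>a\<in>v ` ?C. (\<lambda>c. c \<otimes>\<^bsub>G Mod N\<^esub> ?q (w a)) ` ?q ` ?R)"
    by (rule card_mono [OF finite_UN_I [OF finv finite_imageI [OF finR]] cover])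
  also have "\<dots> \<le> (\<Sum>a\<in>v ` ?C. card ((\<lambda>c. c \<otimes>\<^bsub>G Mod N\<^esub> ?q (w a)) ` ?q ` ?R))"
    by (rule card_UN_le [OF finv])
  also have "\<dots> \<le> (\<Sum>a\<in>v ` ?C. card (?q ` ?R))"
    by (rule sum_mono) (rule card_image_le [OF finR])
  also have "\<dots> = card (v ` ?C) * card (?q ` ?R)" by simp
  also have "\<dots> \<le> card V * card (?q ` ?R)" by (intro mult_right_mono card_mono V(1) vV) simp
  finally have "real (card (?q ` ?C)) \<le> real (card V) * real (card (?q ` ?R))"
    by (metis of_nat_le_iff of_nat_mult)
  then show ?thesis
    unfolding measure_saturated [OF N satC] measure_saturated [OF N satR]
      by (simp add: divide_right_mono)
qed

text \<open>The pairs with trivial wedge are the commuting pairs with trivial wedge at one fixed level \<open>M\<close>.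
  They are therefore approximated by the pairs that commute modulo \<open>N\<close> and have trivial wedge at
  level \<open>M\<close>, and for small \<open>N\<close> the measure of the latter is estimated slice by slice.\<close>

lemma exterior_degree_lower_bound:
  assumes fin: "finite (schur_multiplier p G T)"
  shows "measure \<mu> (exterior_center p G T) + 1 / real (card (schur_multiplier p G T))
           * (measure \<nu> commuting_pairs - measure \<mu> (exterior_center p G T)) \<le> measure \<nu>
               wedge_pairs"
proof -
  let ?E = "exterior_center p G T"
  define h where "h = card (schur_multiplier p G T)"
  have "exterior_symbol p G T \<one> \<one> \<in> schur_multiplier p G T"
    by (intro exterior_symbol_in_schur_multiplier) simp_all
  then have h: "h \<ge> 1" using fin by (auto simp: h_def Suc_le_eq card_gt_0_iff)
  obtain M where M: "M \<in> P" "commuting_pairs \<inter> wedge_level M \<subseteq> wedge_pairs"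
    using wedge_pairs_at_finite_level [OF fin] .
  obtain N1 where N1: "N1 \<in> P" "level_value M ` commuting_level N1 \<subseteq> level_value M `
      commuting_pairs"
    using commuting_values_at_finite_level [OF M(1)] .
  define S where "S N = commuting_level N \<inter> wedge_level M" for N
  have S_closed: "closedin (prod_topology T T) (S N)" if "N \<in> P" for N
    unfolding S_def by (intro closedin_Int closedin_commuting_level closedin_wedge_level that M(1))
  have S_mono: "S N \<subseteq> S N'" if "N \<subseteq> N'" for N N'
    unfolding S_def using commuting_level_mono [OF that] by blast
  have "(\<Inter>N\<in>P. S N) = commuting_pairs \<inter> wedge_level M"
    unfolding S_def commuting_pairs_eq using carrier_in_P by blast
  then have S_Inter: "(\<Inter>N\<in>P. S N) \<subseteq> wedge_pairs" using M(2) by simp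
  have "measure \<mu> ?E + 1 / real h * (measure \<nu> commuting_pairs - measure \<mu> ?E) \<le> measure \<nu>
      wedge_pairs"
  proof (rule field_le_epsilon)
    fix e :: real assume e: "e > 0"
    obtain N2 where N2: "N2 \<in> P" "measure \<nu> (S N2) < measure \<nu> (\<Inter>N\<in>P. S N) + e"
      using radon_limit [OF compact_TT radon_\<nu> S_closed S_mono e] .
    define N where "N = M \<inter> N1 \<inter> N2"
    have N: "N \<in> P" unfolding N_def by (intro P_Int M(1) N1(1) N2(1))
    have NM: "N \<subseteq> M" by (auto simp: N_def)
    have vals: "level_value M ` commuting_level N \<subseteq> level_value M ` commuting_pairs"
      using N1(2) commuting_level_mono [of N N1] by (auto simp: N_def)
    have satS: "pair_saturated N (S N)"
      using pair_saturated_commuting_level [OF N] pair_saturated_mono [OF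
          pair_saturated_wedge_level [OF M(1)] N M(1) NM]
      unfolding S_def pair_saturated_def by blast
    have slices: "measure \<nu> R = (\<Sum>c\<in>rcosets N. measure \<mu> c * measure \<mu> (R `` c))" if R:
        "pair_saturated N R" for R
    proof -
      have "R \<inter> (carrier G \<times> carrier G) = R" using pair_saturated_carrier [OF R] by blast
      moreover have "carrier G \<inter> c = c" if "c \<in> rcosets N" for c
        using subgroup.rcosets_carrier [OF P_subgroup [OF N] is_group that] by blast
      ultimately show ?thesis using measure_slices [OF N R carrier_in_sets] by simp
    qed
    \<comment> \<open>Over a coset that meets the exterior center the slice is everything. This is better than the
      bound from the index and is what the summand with the exterior center accounts for.\<close>
    have term_le: "1 / h * (measure \<mu> c * measure \<mu> (commuting_level N `` c)) + (1 - 1 / h) *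
        measure \<mu> (?E \<inter> c)
        \<le> measure \<mu> c * measure \<mu> (S N `` c)" if c: "c \<in> rcosets N" for c
    proof (cases "?E \<inter> c = {}")
      case True
      obtain z where z: "z \<in> carrier G" "c = N #> z" using c by (rule rcosetsE)
      have "measure \<mu> (commuting_level N `` c) \<le> card (level_value M ` commuting_pairs) * measure
          \<mu> (S N `` c)"
        using measure_centralizer_le [OF M(1) N NM z(1) level_values_bound(1) [OF M(1) fin] vals]
        unfolding z(2) Image_r_coset [OF N satS z(1)] Image_r_coset [OF N
            pair_saturated_commuting_level [OF N] z(1)]
        by (simp add: S_def)
      also have "\<dots> \<le> h * measure \<mu> (S N `` c)"
        using level_values_bound(2) [OF M(1) fin] unfolding h_def by (intro mult_right_mono) auto
      finally have "1 / h * measure \<mu> (commuting_level N `` c) \<le> measure \<mu> (S N `` c)"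
        using h by (simp add: field_simps)
      then have "measure \<mu> c * (1 / h * measure \<mu> (commuting_level N `` c)) \<le> measure \<mu> c *
          measure \<mu> (S N `` c)"
        by (intro mult_left_mono) simp_all
      then show ?thesis using True by (simp add: mult.left_commute)
    next
      case False
      then obtain z where z: "z \<in> ?E" "z \<in> c" by blast
      then have zG: "z \<in> carrier G" by (simp add: exterior_center_def)
      obtain x where x: "x \<in> carrier G" "c = N #> x" using c by (rule rcosetsE)
      have cz: "c = N #> z" using r_cosetD(2) [OF N x(1)] z(2) x(2) by simp
      have "(z, y) \<in> S N" if "y \<in> carrier G" for y
      proof -
        have "(z, y) \<in> wedge_pairs" using z(1) that
          by (simp add: exterior_center_def wedge_pairs_def)
        then show ?thesis
          using wedge_level_subset_commuting_level [OF N] N M(1) unfolding wedge_pairs_eq S_def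
            by blast
      qed
      then have "{y. (z, y) \<in> S N} = carrier G" using pair_saturated_carrier [OF satS] by blast
      then have one: "measure \<mu> (S N `` c) = 1"
        unfolding cz Image_r_coset [OF N satS zG] by simp
      have "1 / h * (measure \<mu> c * measure \<mu> (commuting_level N `` c)) \<le> 1 / h * (measure \<mu> c * 1)"
        by (intro mult_left_mono measure_le_one) simp_all
      moreover have "(1 - 1 / h) * measure \<mu> (?E \<inter> c) \<le> (1 - 1 / h) * measure \<mu> c"
        using h by (intro mult_left_mono m.finite_measure_mono coset_in_sets [OF N c]) auto
      ultimately show ?thesis unfolding one by (simp add: algebra_simps)
    qed
    have commuting_sets: "commuting_level N \<in> sets \<nu>"
      by (rule radon_closed [OF radon_\<nu> closedin_commuting_level [OF N]])
    have "measure \<mu> ?E + 1 / h * (measure \<nu> commuting_pairs - measure \<mu> ?E)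
        \<le> measure \<mu> ?E + 1 / h * (measure \<nu> (commuting_level N) - measure \<mu> ?E)"
      using n.finite_measure_mono [OF _ commuting_sets, of commuting_pairs] N
      by (intro add_left_mono mult_left_mono diff_right_mono) (auto simp: commuting_pairs_eq)
    also have "\<dots> = 1 / h * measure \<nu> (commuting_level N) + (1 - 1 / h) * measure \<mu> ?E"
      by (simp add: algebra_simps)
    also have "\<dots> = (\<Sum>c\<in>rcosets N. 1 / h * (measure \<mu> c * measure \<mu> (commuting_level N `` c)) + (1
        - 1 / h) * measure \<mu> (?E \<inter> c))"
      unfolding slices [OF pair_saturated_commuting_level [OF N]] sum_measure_Int_rcosets [OF N
          exterior_center_sets, symmetric]
      by (simp only: sum.distrib sum_distrib_left)
    also have "\<dots> \<le> (\<Sum>c\<in>rcosets N. measure \<mu> c * measure \<mu> (S N `` c))"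
      by (rule sum_mono) (rule term_le)
    also have "\<dots> = measure \<nu> (S N)" by (rule slices [OF satS, symmetric])
    also have "\<dots> \<le> measure \<nu> (S N2)"
      by (intro n.finite_measure_mono S_mono radon_closed [OF radon_\<nu> S_closed [OF N2(1)]]) (auto
          simp: N_def)
    also have "\<dots> \<le> measure \<nu> (\<Inter>N\<in>P. S N) + e" using N2(2) by simp
    also have "\<dots> \<le> measure \<nu> wedge_pairs + e"
      using n.finite_measure_mono [OF S_Inter wedge_pairs_sets] by simp
    finally show "measure \<mu> ?E + 1 / real h * (measure \<nu> commuting_pairs - measure \<mu> ?E) \<le> measure
        \<nu> wedge_pairs + e" .
  qed
  then show ?thesis by (simp add: h_def)
qed

end

theorem theorem3p7:
  fixes p :: nat and G :: "('a, 'm) monoid_scheme" and T :: "'a topology"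
    and \<mu> :: "'a measure" and \<nu> :: "('a \<times> 'a) measure"
  assumes "prime p"
    and "pro_p_group p G T"
    and "normalized_haar_measure G T \<mu>"
    and "radon_product T \<mu> \<nu>"
  shows "exterior_degree p G T \<nu> \<le> commutativity_degree G \<nu>
           - ((real p - 1) / real p)
             * (measure \<mu> (group_center G) - measure \<mu> (exterior_center p G T))
         \<and> (finite (schur_multiplier p G T) \<longrightarrow>
             exterior_degree p G T \<nu> \<ge> measure \<mu> (exterior_center p G T)
               + 1 / real (card (schur_multiplier p G T))
                 * (commutativity_degree G \<nu> - measure \<mu> (exterior_center p G T)))"
proof -
  have "group G" using assms(2) by (simp add: pro_p_group_def topological_group_def)
  then interpret pro_p_haar G p T \<mu> \<nu>
    using assms by (simp add: pro_p_haar_def pro_p_haar_axioms_def pro_p_def pro_p_axioms_def)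
  have "exterior_degree p G T \<nu> = measure \<nu> wedge_pairs"
    by (simp add: exterior_degree_def wedge_pairs_def)
  moreover have "commutativity_degree G \<nu> = measure \<nu> commuting_pairs"
    by (simp add: commutativity_degree_def commuting_pairs_def)
  ultimately show ?thesis using exterior_degree_upper_bound exterior_degree_lower_bound by simp
qed

end
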